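(* Let $p$ be a prime and let $(G,G_\bullet)$ be a filtered group. The group nilspace associated with $(G,G_\bullet)$ is a $p$-homogeneous nilspace if and only if $G_\bullet$ is a $p$-homogeneous filtration, i.e. for every $i\ge 0$ and every $g\in G_i$ we have $g^p\in G_{i+p-1}$.
   Context: Filtered groups. A filtration $G_\bullet=(G_i)_{i\ge0}$ on a group $G$ is a sequence of subgroups $G=G_0=G_1\ge G_2\ge\cdots$ with $[G_i,G_j]\subset G_{i+j}$ for all $i,j$. The group nilspace associated with $(G,G_\bullet)$ is the set $G$ with cube sets $C^n(G_\bullet)$, $n\ge0$, where $C^n(G_\bullet)$ (Host–Kra cubes) is the subgroup of $G^{\{0,1\}^n}$ generated by the elements $g^F$, for $F$ a face of $\{0,1\}^n$ of codimension $i$ and $g\in G_i$, with $g^F(v)=g$ for $v\in F$ and $g^F(v)=\mathrm{id}$ otherwise. Nilspaces. A nilspace is a set $X$ with sets $C^n(X)\subset X^{\{0,1\}^n}$, $n\ge0$ (the $n$-cubes), such that: (composition) $c\circ\phi\in C^m(X)$ for every $c\in C^n(X)$ and every $\phi:\{0,1\}^m\to\{0,1\}^n$ that is the restriction of an affine homomorphism $\mathbb{Z}^m\to\mathbb{Z}^n$; (ergodicity) $C^1(X)=X^{\{0,1\}}$; (completion) every map $c':\{0,1\}^n\setminus\{1^n\}\to X$ whose restriction to each face $\{v:v_i=0\}$ is an $(n-1)$-cube extends to an element of $C^n(X)$ (here $1^n=(1,\dots,1)$). A morphism $X\to Y$ is a map $f$ with $f\circ c\in C^n(Y)$ for all $n$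 and $c\in C^n(X)$; $\hom(X,Y)$ is the set of morphisms. For an abelian group $A$, $\mathcal{D}_1(A)$ is the nilspace on $A$ whose $n$-cubes are the maps $v\mapsto x+v_1h_1+\dots+v_nh_n$ with $x,h_i\in A$. A nilspace $X$ is $p$-homogeneous if for every $n\ge1$ and every $f\in\hom(\mathcal{D}_1(\mathbb{Z}^n),X)$, the restriction $f|_{[0,p-1]^n}$ is in $\hom(\mathcal{D}_1(\mathbb{Z}_p^n),X)$, where $[0,p-1]^n$ is identified with $\mathbb{Z}_p^n$ (addition mod $p$). *)

theory Defs
  imports "HOL-Algebra.Product_Groups" "HOL-Algebra.FiniteProduct" "HOL-Computational_Algebra.Primes"
begin

section \<open>Discrete cubes\<close>

text \<open>
  Points of \<open>\<int>\<^sup>n\<close>, and in particular of \<open>{0,1}\<^sup>n\<close>, are extensional functions on the index set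
  \<open>{..<n}\<close>; coordinates are numbered from \<open>0\<close>. Maps on \<open>{0,1}\<^sup>n\<close> are extensional
  functions on \<open>cube n\<close>.
\<close>

definition int_power_group :: "nat \<Rightarrow> (nat \<Rightarrow> int) monoid" where
  "int_power_group n = product_group {..<n} (\<lambda>_. integer_group)"

definition mod_power_group :: "nat \<Rightarrow> nat \<Rightarrow> (nat \<Rightarrow> int) monoid" where
  "mod_power_group p n = product_group {..<n} (\<lambda>_. integer_mod_group p)"

definition cube :: "nat \<Rightarrow> (nat \<Rightarrow> int) set" where
  "cube n = {..<n} \<rightarrow>\<^sub>E {0, 1}"

definition cube_top :: "nat \<Rightarrow> (nat \<Rightarrow> int)" where
  "cube_top n = (\<lambda>i\<in>{..<n}. 1)"

definition cube_morphism :: "nat \<Rightarrow> nat \<Rightarrow> ((nat \<Rightarrow> int) \<Rightarrow> (nat \<Rightarrow> int)) \<Rightarrow> bool" where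
  "cube_morphism m n \<phi> \<longleftrightarrow>
     \<phi> \<in> cube m \<rightarrow>\<^sub>E cube n \<and>
     (\<exists>a \<in> carrier (int_power_group n). \<exists>h \<in> hom (int_power_group m) (int_power_group n).
        \<forall>v \<in> cube m. \<phi> v = a \<otimes>\<^bsub>int_power_group n\<^esub> h v)"

definition faces :: "nat \<Rightarrow> nat \<Rightarrow> (nat \<Rightarrow> int) set set" where
  "faces n i = {{v \<in> cube n. \<forall>j\<in>J. v j = w j} | J w. J \<subseteq> {..<n} \<and> card J = i \<and> w \<in> cube n}"

text \<open>
  The identification of \<open>{0,1}\<^sup>n\<close> with the face \<open>v\<^sub>i = 0\<close> of \<open>{0,1}\<^sup>n\<^sup>+\<^sup>1\<close>, inserting a \<open>0\<close> at position \<open>i\<close>.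
\<close>

definition insert_zero :: "nat \<Rightarrow> nat \<Rightarrow> (nat \<Rightarrow> int) \<Rightarrow> (nat \<Rightarrow> int)" where
  "insert_zero n i v =
     (\<lambda>k\<in>{..<Suc n}. if k < i then v k else if k = i then 0 else v (k - 1))"


section \<open>Nilspaces\<close>

record 'a cubespace =
  points :: "'a set"
  cubes :: "nat \<Rightarrow> ((nat \<Rightarrow> int) \<Rightarrow> 'a) set"

text \<open>
  In the completion axiom the dimension is \<open>Suc n\<close>, since the hypothesis speaks of cubes of one
  dimension less.
\<close>

locale nilspace =
  fixes X :: "'a cubespace"
  assumes cubes_subset: "cubes X n \<subseteq> cube n \<rightarrow>\<^sub>E points X"
    and composition: "\<lbrakk>c \<in> cubes X n; cube_morphism m n \<phi>\<rbrakk> \<Longrightarrow> compose (cube m) c \<phi> \<in> cubes X m"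
    and ergodicity: "cubes X 1 = (cube 1 \<rightarrow>\<^sub>E points X)"
    and completion:
      "\<lbrakk>c' \<in> (cube (Suc n) - {cube_top (Suc n)}) \<rightarrow>\<^sub>E points X;
        \<And>i. i < Suc n \<Longrightarrow> (\<lambda>v\<in>cube n. c' (insert_zero n i v)) \<in> cubes X n\<rbrakk>
       \<Longrightarrow> \<exists>c \<in> cubes X (Suc n). \<forall>v \<in> cube (Suc n) - {cube_top (Suc n)}. c v = c' v"

definition nilspace_hom :: "'a cubespace \<Rightarrow> 'b cubespace \<Rightarrow> ('a \<Rightarrow> 'b) set" where
  "nilspace_hom X Y =
     {f \<in> points X \<rightarrow>\<^sub>E points Y. \<forall>n. \<forall>c \<in> cubes X n. compose (cube n) f c \<in> cubes Y n}"

text \<open>The nilspace \<open>\<D>\<^sub>1(A)\<close> of an abelian group \<open>A\<close>, written multiplicatively.\<close>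

definition degree1_nilspace :: "('a, 'b) monoid_scheme \<Rightarrow> 'a cubespace" where
  "degree1_nilspace A =
     \<lparr>points = carrier A,
      cubes = (\<lambda>n. {(\<lambda>v\<in>cube n. x \<otimes>\<^bsub>A\<^esub> (\<Otimes>\<^bsub>A\<^esub>i\<in>{..<n}. h i [^]\<^bsub>A\<^esub> v i)) | x h.
                      x \<in> carrier A \<and> h \<in> {..<n} \<rightarrow> carrier A})\<rparr>"

text \<open>
  For \<open>p > 0\<close> the carrier of \<^term>\<open>integer_mod_group p\<close> is \<open>{0..<p}\<close>, so the carrier of
  \<^term>\<open>mod_power_group p n\<close> is literally the box \<open>[0,p-1]\<^sup>n\<close> inside \<open>\<int>\<^sup>n\<close>.
\<close>

definition p_homogeneous_nilspace :: "nat \<Rightarrow> 'a cubespace \<Rightarrow> bool" where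
  "p_homogeneous_nilspace p X \<longleftrightarrow>
     nilspace X \<and>
     (\<forall>n\<ge>1. \<forall>f \<in> nilspace_hom (degree1_nilspace (int_power_group n)) X.
        restrict f (carrier (mod_power_group p n))
          \<in> nilspace_hom (degree1_nilspace (mod_power_group p n)) X)"


section \<open>Filtered groups\<close>

definition commutator_subgroup :: "('a, 'b) monoid_scheme \<Rightarrow> 'a set \<Rightarrow> 'a set \<Rightarrow> 'a set" where
  "commutator_subgroup G H K =
     generate G (\<Union>h\<in>H. \<Union>k\<in>K. {h \<otimes>\<^bsub>G\<^esub> k \<otimes>\<^bsub>G\<^esub> inv\<^bsub>G\<^esub> h \<otimes>\<^bsub>G\<^esub> inv\<^bsub>G\<^esub> k})"

locale filtered_group = group G for G (structure) +
  fixes F :: "nat \<Rightarrow> 'a set"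
  assumes filtration_subgroup: "subgroup (F i) G"
    and filtration_0: "F 0 = carrier G"
    and filtration_1: "F 1 = carrier G"
    and filtration_decreasing: "F (Suc i) \<subseteq> F i"
    and filtration_commutator: "commutator_subgroup G (F i) (F j) \<subseteq> F (i + j)"

definition face_element ::
    "('a, 'b) monoid_scheme \<Rightarrow> nat \<Rightarrow> 'a \<Rightarrow> (nat \<Rightarrow> int) set \<Rightarrow> ((nat \<Rightarrow> int) \<Rightarrow> 'a)" where
  "face_element G n g S = (\<lambda>v\<in>cube n. if v \<in> S then g else \<one>\<^bsub>G\<^esub>)"

definition host_kra_cubes ::
    "('a, 'b) monoid_scheme \<Rightarrow> (nat \<Rightarrow> 'a set) \<Rightarrow> nat \<Rightarrow> ((nat \<Rightarrow> int) \<Rightarrow> 'a) set" where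
  "host_kra_cubes G F n =
     generate (product_group (cube n) (\<lambda>_. G))
       {face_element G n g S | g S i. S \<in> faces n i \<and> g \<in> F i}"

definition group_nilspace :: "('a, 'b) monoid_scheme \<Rightarrow> (nat \<Rightarrow> 'a set) \<Rightarrow> 'a cubespace" where
  "group_nilspace G F = \<lparr>points = carrier G, cubes = host_kra_cubes G F\<rparr>"

definition p_homogeneous_filtration ::
    "nat \<Rightarrow> ('a, 'b) monoid_scheme \<Rightarrow> (nat \<Rightarrow> 'a set) \<Rightarrow> bool" where
  "p_homogeneous_filtration p G F \<longleftrightarrow> (\<forall>i. \<forall>g \<in> F i. g [^]\<^bsub>G\<^esub> p \<in> F (i + p - 1))"

end

theory Submission
  imports Defs "HOL-Number_Theory.Cong" Complex_Main
begin

text \<open>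
  Write \<open>G\<^sub>i\<close> for \<open>F i\<close>. Both directions rest on two facts about Host-Kra cubes.

  The first (\<open>is_cube_top_value\<close>) is that an \<open>n\<close>-cube equal to the identity at every vertex but \<open>1\<^sup>n\<close>
  takes a value in \<open>G\<^sub>n\<close> at that vertex. It is obtained by localising the Host-Kra group one
  coordinate at a time: a cube is a product of one that does not depend on a given coordinate and one
  that lives on the face where this coordinate is \<open>1\<close>.

  The second (\<open>is_cube_pow_weighted_poly\<close>) says which integer exponents produce cubes: if
  the \<open>q\<^sup>t\<close>-th power of \<open>g\<close> is in \<open>G\<^bsub>k+tr\<^esub>\<close> for all \<open>t\<close>, then \<open>v \<mapsto> g\<^bsup>E(v)\<^esup>\<close> is a cube as soon as \<open>E\<close> is a combination of
  monomials \<open>q\<^sup>t \<Prod>\<^bsub>j\<in>S\<^esub> v\<^sub>j\<close> with \<open>|S| \<le> k + tr\<close>. Such \<open>E\<close> are said to have weighted degree at most \<open>k\<close>;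
  weighted degrees add up under multiplication. For \<open>q = 0\<close> this is the usual degree and the
  hypothesis on \<open>g\<close> only says \<open>g \<in> G\<^sub>k\<close>; for \<open>q = p\<close> and \<open>r = p - 1\<close> the hypothesis follows from
  \<open>g \<in> G\<^sub>k\<close> when the filtration is \<open>p\<close>-homogeneous.

  If the nilspace is \<open>p\<close>-homogeneous and \<open>g \<in> G\<^sub>i\<close>, \<open>i \<ge> 1\<close>, take the morphism
  \<open>x \<mapsto> g\<close> to the power \<open>x\<^sub>1 \<cdots> x\<^sub>i\<close> on \<open>\<int>\<^sup>i\<close>, and substitute for \<open>x\<^sub>1\<close> the sum of \<open>p\<close> cube coordinates and
  for the other \<open>x\<^sub>k\<close> one further coordinate each. Computing the sum in \<open>\<int>\<close> or modulo \<open>p\<close> gives two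
  cubes of dimension \<open>i + p - 1\<close>. They differ only at the top vertex, where the sum is \<open>p\<close> in one case
  and \<open>0\<close> in the other. Hence \<open>g\<^sup>p\<close> is the top value of a cube that is trivial elsewhere, and lies in
  \<open>G\<^bsub>i+p-1\<^esub>\<close>.

  Conversely let the filtration be \<open>p\<close>-homogeneous and let \<open>f\<close> be a morphism on \<open>\<int>\<^sup>n\<close>. Its values on the
  box \<open>[0,p-1]\<^sup>n\<close> are those of a finite product of maps \<open>x \<mapsto> g\<close> to the power \<open>\<Prod>\<^sub>k binom(x\<^sub>k, \<alpha>\<^sub>k)\<close> with
  \<open>\<alpha>\<close> in the box and \<open>g \<in> G\<^bsub>|\<alpha>|\<^esub>\<close> (a noncommutative Newton expansion; that \<open>g\<close> is that deep in the
  filtration is the first fact again). So it suffices that \<open>binom(L(v) mod p, a)\<close> has weighted degree at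
  most \<open>a\<close> for \<open>a < p\<close> and \<open>L\<close> affine. This holds because the \<open>s\<close>-th difference of the \<open>p\<close>-periodic
  function \<open>z \<mapsto> binom(z mod p, a)\<close> is divisible by \<open>p\<^sup>t\<close> whenever \<open>s > a + (t-1)(p-1)\<close>: on periodic
  functions \<open>\<Delta>\<^sup>p\<close> is \<open>p\<close> times an integer combination of \<open>\<Delta>, \<dots>, \<Delta>\<^bsup>p-1\<^esup>\<close>.
\<close>


section \<open>Points of discrete cubes and coordinatewise maps\<close>

lemma cube_coord: "v \<in> cube n \<Longrightarrow> j < n \<Longrightarrow> v j = 0 \<or> v j = 1"
  by (auto simp: cube_def PiE_iff)

lemma cube_top_in_cube: "cube_top n \<in> cube n"
  by (auto simp: cube_top_def cube_def PiE_iff extensional_def)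

lemma fun_upd_in_cube: "v \<in> cube n \<Longrightarrow> a < n \<Longrightarrow> b \<in> {0, 1} \<Longrightarrow> v(a := b) \<in> cube n"
  by (auto simp: cube_def PiE_iff extensional_def)

lemma cube_eqI: "v \<in> cube n \<Longrightarrow> w \<in> cube n \<Longrightarrow> (\<And>j. j < n \<Longrightarrow> v j = w j) \<Longrightarrow> v = w"
  unfolding cube_def by (rule PiE_ext) auto

lemma cube_eq_topI: "v \<in> cube n \<Longrightarrow> (\<And>j. j < n \<Longrightarrow> v j = 1) \<Longrightarrow> v = cube_top n"
  by (rule cube_eqI[OF _ cube_top_in_cube]) (auto simp: cube_top_def)

lemma prod_cube_coords:
  assumes "v \<in> cube n" "S \<subseteq> {..<n}"
  shows "(\<Prod>j\<in>S. v j) = (if \<forall>j\<in>S. v j = 1 then 1 else 0)"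
proof (cases "\<forall>j\<in>S. v j = 1")
  case False
  then obtain j where "j \<in> S" "v j \<noteq> 1" by blast
  moreover have "finite S" using assms finite_subset by blast
  ultimately show ?thesis
    using assms cube_coord[of v n j] by (auto intro!: prod_zero)
qed auto

lemma sum_cube_eq_card_iff:
  assumes "v \<in> cube n" "A \<subseteq> {..<n}"
  shows "0 \<le> (\<Sum>j\<in>A. v j)" "(\<Sum>j\<in>A. v j) \<le> int (card A)"
    and "(\<Sum>j\<in>A. v j) = int (card A) \<longleftrightarrow> (\<forall>j\<in>A. v j = 1)"
proof -
  have A: "finite A" using assms finite_subset by blast
  have v: "v j = 0 \<or> v j = 1" if "j \<in> A" for j using assms cube_coord that by blast
  show "0 \<le> (\<Sum>j\<in>A. v j)" using v by (intro sum_nonneg) force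
  have le: "(\<Sum>j\<in>A. v j) \<le> (\<Sum>j\<in>A. 1)" using v by (intro sum_mono) force
  then show "(\<Sum>j\<in>A. v j) \<le> int (card A)" by simp
  show "(\<Sum>j\<in>A. v j) = int (card A) \<longleftrightarrow> (\<forall>j\<in>A. v j = 1)"
  proof
    assume eq: "(\<Sum>j\<in>A. v j) = int (card A)"
    have "(\<Sum>j\<in>A. 1 - v j) = 0" using eq by (simp add: sum_subtractf)
    moreover have "0 \<le> 1 - v j" if "j \<in> A" for j using v[OF that] by auto
    ultimately have "\<forall>j\<in>A. 1 - v j = 0" using sum_nonneg_eq_0_iff[OF A, of "\<lambda>j. 1 - v j"] by simp
    then show "\<forall>j\<in>A. v j = 1" by simp
  qed simp
qed

text \<open>
  Each coordinate of the image is constant or determines, and is determined by, one coordinate of the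
  argument. This is all that is used of a cube morphism: it makes preimages of faces faces, of no
  larger codimension. Deleting a coordinate and setting one to \<open>0\<close> are of this kind as well.
\<close>
definition coordinatewise :: "nat \<Rightarrow> nat \<Rightarrow> ((nat \<Rightarrow> int) \<Rightarrow> (nat \<Rightarrow> int)) \<Rightarrow> bool" where
  "coordinatewise m n \<phi> \<longleftrightarrow> \<phi> \<in> cube m \<rightarrow> cube n \<and>
     (\<forall>j<n. (\<forall>v\<in>cube m. \<forall>v'\<in>cube m. \<phi> v j = \<phi> v' j) \<or>
        (\<exists>l<m. \<forall>v\<in>cube m. \<forall>v'\<in>cube m. \<phi> v j = \<phi> v' j \<longleftrightarrow> v l = v' l))"

text \<open>
  A nonempty preimage of a face contains some \<open>u\<close>, and the face is then cut out by the values of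
  \<open>\<phi> u\<close>. Constant coordinates impose nothing and every other one fixes one coordinate of \<open>v\<close>.
\<close>
lemma coordinatewise_vimage_face:
  assumes \<phi>: "coordinatewise m n \<phi>" and K: "K \<subseteq> {..<n}" and u: "u \<in> cube m"
  shows "\<exists>L \<subseteq> {..<m}. card L \<le> card K \<and>
     (\<forall>v\<in>cube m. (\<forall>j\<in>K. \<phi> v j = \<phi> u j) \<longleftrightarrow> (\<forall>l\<in>L. v l = u l))"
proof -
  define K' where "K' = {j \<in> K. \<not> (\<forall>v\<in>cube m. \<phi> v j = \<phi> u j)}"
  have "\<exists>l<m. \<forall>v\<in>cube m. \<phi> v j = \<phi> u j \<longleftrightarrow> v l = u l" if "j \<in> K'" for j
    using \<phi> K u that unfolding coordinatewise_def K'_def by blast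
  then obtain l where l: "\<And>j. j \<in> K' \<Longrightarrow> l j < m"
      "\<And>j v. j \<in> K' \<Longrightarrow> v \<in> cube m \<Longrightarrow> \<phi> v j = \<phi> u j \<longleftrightarrow> v (l j) = u (l j)"
    by metis
  have "finite K" using K finite_subset by blast
  then have "card (l ` K') \<le> card K"
    using card_image_le[of K' l] card_mono[of K K'] by (force simp: K'_def)
  moreover have "(\<forall>j\<in>K. \<phi> v j = \<phi> u j) \<longleftrightarrow> (\<forall>i\<in>l ` K'. v i = u i)" if v: "v \<in> cube m" for v
  proof -
    have "(\<forall>j\<in>K. \<phi> v j = \<phi> u j) \<longleftrightarrow> (\<forall>j\<in>K'. \<phi> v j = \<phi> u j)"
      using v by (auto simp: K'_def)
    then show ?thesis using l(2) v by simp
  qed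
  ultimately show ?thesis using l(1) by (intro exI[of _ "l ` K'"]) auto
qed

lemma int_power_group_eq: "int_power_group n = mod_power_group 0 n"
  by (simp add: int_power_group_def mod_power_group_def integer_mod_group_def)

lemma carrier_int_power_group: "carrier (int_power_group n) = {..<n} \<rightarrow>\<^sub>E UNIV"
  by (simp add: int_power_group_def)

lemma carrier_mod_power_group:
  "p > 0 \<Longrightarrow> carrier (mod_power_group p n) = {..<n} \<rightarrow>\<^sub>E {0..<int p}"
  by (simp add: mod_power_group_def carrier_integer_mod_group)

text \<open>
  A coordinate of an affine map is \<open>a + \<Sum>\<^sub>l x\<^sub>l v\<^sub>l\<close>. If \<open>x\<^sub>l\<close> and \<open>x\<^bsub>l'\<^esub>\<close> were both nonzero, then
  \<open>a\<close>, \<open>a + x\<^sub>l\<close>, \<open>a + x\<^bsub>l'\<^esub>\<close> and \<open>a + x\<^sub>l + x\<^bsub>l'\<^esub>\<close> could not all lie in \<open>{0, 1}\<close>.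
\<close>
lemma cube_morphism_coordinatewise:
  assumes "cube_morphism m n \<phi>"
  shows "coordinatewise m n \<phi>"
proof -
  have \<phi>: "\<And>v. v \<in> cube m \<Longrightarrow> \<phi> v \<in> cube n"
    using assms unfolding cube_morphism_def by blast
  obtain a h where h: "h \<in> hom (int_power_group m) (int_power_group n)"
      and ah: "\<And>v. v \<in> cube m \<Longrightarrow> \<phi> v = a \<otimes>\<^bsub>int_power_group n\<^esub> h v"
    using assms unfolding cube_morphism_def by blast
  define ind where "ind B = (\<lambda>i\<in>{..<m}. if i \<in> B then 1 else 0 :: int)" for B
  have ind_cube: "ind B \<in> cube m" for B
    by (auto simp: ind_def cube_def)
  have "(\<forall>v\<in>cube m. \<forall>v'\<in>cube m. \<phi> v j = \<phi> v' j) \<or>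
        (\<exists>l<m. \<forall>v\<in>cube m. \<forall>v'\<in>cube m. \<phi> v j = \<phi> v' j \<longleftrightarrow> v l = v' l)" if j: "j < n" for j
  proof -
    define x where "x l = h (ind {l}) j" for l
    have h_add: "h (\<lambda>i\<in>{..<m}. u i + w i) j = h u j + h w j"
      if "u \<in> {..<m} \<rightarrow>\<^sub>E UNIV" "w \<in> {..<m} \<rightarrow>\<^sub>E UNIV" for u w
      using hom_mult[OF h, of u w] that j
      by (auto simp: int_power_group_def dest!: fun_cong[where x = j])
    have ind_E: "ind B \<in> {..<m} \<rightarrow>\<^sub>E UNIV" for B by (simp add: ind_def)
    have h_ind: "h (ind B) j = (\<Sum>l\<in>B. x l)" if "finite B" "B \<subseteq> {..<m}" for B
      using that
    proof (induction B)
      case empty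
      have "ind {} = (\<lambda>i\<in>{..<m}. ind {} i + ind {} i)" by (auto simp: ind_def)
      then show ?case using h_add[OF ind_E[of "{}"] ind_E[of "{}"]] by simp
    next
      case (insert l B)
      then have "ind (insert l B) = (\<lambda>i\<in>{..<m}. ind {l} i + ind B i)"
        by (auto simp: ind_def fun_eq_iff)
      then have "h (ind (insert l B)) j = h (ind {l}) j + h (ind B) j"
        using h_add[OF ind_E[of "{l}"] ind_E[of B]] by (simp only:)
      then show ?case using insert by (simp add: x_def)
    qed
    have \<phi>_eq: "\<phi> v j = a j + (\<Sum>l\<in>{l. l < m \<and> v l = 1}. x l)" if v: "v \<in> cube m" for v
    proof -
      have "ind {l. l < m \<and> v l = 1} = v"
        by (rule cube_eqI[OF ind_cube v]) (use cube_coord[OF v] in \<open>auto simp: ind_def\<close>)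
      moreover have "h (ind {l. l < m \<and> v l = 1}) j = (\<Sum>l\<in>{l. l < m \<and> v l = 1}. x l)"
        by (rule h_ind) auto
      ultimately show ?thesis using ah[OF v] j by (simp add: int_power_group_def)
    qed
    show ?thesis
    proof (cases "\<forall>l<m. x l = 0")
      case True
      then show ?thesis by (auto simp: \<phi>_eq)
    next
      case False
      then obtain l where l: "l < m" "x l \<noteq> 0" by blast
      have other: "x l' = 0" if l': "l' < m" "l' \<noteq> l" for l'
      proof -
        have \<phi>_ind: "\<phi> (ind B) j = a j + (\<Sum>l\<in>B. x l)" if "B \<subseteq> {..<m}" for B
        proof -
          have "{l. l < m \<and> ind B l = 1} = B" using that by (auto simp: ind_def)
          then show ?thesis using \<phi>_eq[OF ind_cube[of B]] by simp
        qed
        have "\<phi> (ind B) j = 0 \<or> \<phi> (ind B) j = 1" for B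
          using \<phi>[OF ind_cube] j by (rule cube_coord)
        from this[of "{}"] this[of "{l}"] this[of "{l'}"] this[of "{l, l'}"] show ?thesis
          using l l' by (auto simp: \<phi>_ind)
      qed
      have "(\<Sum>l'\<in>{l'. l' < m \<and> v l' = 1}. x l') = (if v l = 1 then x l else 0)" for v :: "nat \<Rightarrow> int"
      proof -
        have "(\<Sum>l'\<in>{l'. l' < m \<and> v l' = 1}. x l') = (\<Sum>l'\<in>{l'. l' < m \<and> v l' = 1}. if l' = l then x l else 0)"
          using other by (intro sum.cong) auto
        also have "\<dots> = (if v l = 1 then x l else 0)"
          using l by (subst sum.delta) auto
        finally show ?thesis .
      qed
      then have "\<phi> v j = \<phi> v' j \<longleftrightarrow> v l = v' l" if "v \<in> cube m" "v' \<in> cube m" for v v'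
        using \<phi>_eq that l cube_coord[OF that(1) l(1)] cube_coord[OF that(2) l(1)] by auto
      then show ?thesis using l by blast
    qed
  qed
  then show ?thesis unfolding coordinatewise_def using \<phi> by blast
qed

text \<open>The coordinate projection that is left inverse to \<^const>\<open>insert_zero\<close>.\<close>
definition delete_coord :: "nat \<Rightarrow> nat \<Rightarrow> (nat \<Rightarrow> int) \<Rightarrow> (nat \<Rightarrow> int)" where
  "delete_coord n k v = (\<lambda>i\<in>{..<n}. if i < k then v i else v (Suc i))"

lemma coordinatewise_delete_coord: "coordinatewise (Suc n) n (delete_coord n k)"
  unfolding coordinatewise_def
proof (intro conjI allI impI disjI2)
  show "delete_coord n k \<in> cube (Suc n) \<rightarrow> cube n"
    by (auto simp: delete_coord_def cube_def PiE_iff)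
  show "\<exists>l<Suc n. \<forall>v\<in>cube (Suc n). \<forall>v'\<in>cube (Suc n). delete_coord n k v j = delete_coord n k v' j \<longleftrightarrow> v l = v' l"
    if "j < n" for j
    using that by (intro exI[of _ "if j < k then j else Suc j"]) (auto simp: delete_coord_def)
qed

lemma insert_zero_in_cube: "v \<in> cube n \<Longrightarrow> i < Suc n \<Longrightarrow> insert_zero n i v \<in> cube (Suc n)"
  by (auto simp: insert_zero_def cube_def PiE_iff)

lemma insert_zero_delete_coord:
  assumes "v \<in> cube (Suc n)" "k < Suc n"
  shows "insert_zero n k (delete_coord n k v) = v(k := 0)"
proof (rule cube_eqI)
  show "insert_zero n k (delete_coord n k v) \<in> cube (Suc n)"
    using insert_zero_in_cube coordinatewise_delete_coord assms unfolding coordinatewise_def by blast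
  show "v(k := 0) \<in> cube (Suc n)" using assms fun_upd_in_cube by simp
  show "insert_zero n k (delete_coord n k v) j = (v(k := 0)) j" if "j < Suc n" for j
    using that assms by (auto simp: insert_zero_def delete_coord_def)
qed

lemma coordinatewise_reset: "k < n \<Longrightarrow> coordinatewise n n (\<lambda>v. v(k := 0))"
  unfolding coordinatewise_def by (auto simp: fun_upd_in_cube)

section \<open>Integer functions of bounded weighted degree\<close>

text \<open>
  Every power of \<open>q\<close> in the coefficient pays for \<open>r\<close> extra variables in the monomial. Functions are
  identified when they agree on the cube, so only squarefree monomials occur. The degree bound \<open>d\<close> is
  an integer that may be negative: taking a difference lowers it by one, and may do so often.
\<close>
inductive_set weighted_poly :: "int \<Rightarrow> nat \<Rightarrow> nat \<Rightarrow> int \<Rightarrow> ((nat \<Rightarrow> int) \<Rightarrow> int) set"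
  for q r n d where
  monomial: "\<lbrakk>S \<subseteq> {..<n}; int (card S) \<le> d + int (t * r)\<rbrakk>
     \<Longrightarrow> (\<lambda>v. a * q ^ t * (\<Prod>j\<in>S. v j)) \<in> weighted_poly q r n d"
| zero: "(\<lambda>v. 0) \<in> weighted_poly q r n d"
| add: "\<lbrakk>E \<in> weighted_poly q r n d; E' \<in> weighted_poly q r n d\<rbrakk>
     \<Longrightarrow> (\<lambda>v. E v + E' v) \<in> weighted_poly q r n d"
| cong: "\<lbrakk>E \<in> weighted_poly q r n d; \<And>v. v \<in> cube n \<Longrightarrow> E' v = E v\<rbrakk>
     \<Longrightarrow> E' \<in> weighted_poly q r n d"

lemma weighted_poly_const: "d \<ge> 0 \<Longrightarrow> (\<lambda>v. a) \<in> weighted_poly q r n d"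
  using weighted_poly.monomial[of "{}" n d 0 r a q] by simp

lemma weighted_poly_coord: "j < n \<Longrightarrow> (\<lambda>v. v j) \<in> weighted_poly q r n 1"
  using weighted_poly.monomial[of "{j}" n 1 0 r 1 q] by simp

text \<open>
  On the cube \<open>v\<^sub>j\<^sup>2 = v\<^sub>j\<close>, so that the product of the monomials of \<open>S\<close> and \<open>T\<close> is the monomial of \<open>S \<union> T\<close>,
  which has at most \<open>|S| + |T|\<close> variables.
\<close>
lemma weighted_poly_monomial_mult:
  assumes "E \<in> weighted_poly q r n e" and S: "S \<subseteq> {..<n}" "int (card S) \<le> d + int (t * r)"
  shows "(\<lambda>v. (a * q ^ t * (\<Prod>j\<in>S. v j)) * E v) \<in> weighted_poly q r n (d + e)"
  using assms(1)
proof induction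
  case (monomial T s b)
  have "card (S \<union> T) \<le> card S + card T"
    by (rule card_Un_le)
  then have "int (card (S \<union> T)) \<le> (d + e) + int ((t + s) * r)"
    using S monomial by (simp add: algebra_simps)
  then have "(\<lambda>v. (a * b) * q ^ (t + s) * (\<Prod>j\<in>S \<union> T. v j)) \<in> weighted_poly q r n (d + e)"
    using S monomial by (intro weighted_poly.monomial) auto
  then show ?case
  proof (rule weighted_poly.cong)
    fix v assume v: "v \<in> cube n"
    show "(a * q ^ t * (\<Prod>j\<in>S. v j)) * (b * q ^ s * (\<Prod>j\<in>T. v j))
            = (a * b) * q ^ (t + s) * (\<Prod>j\<in>S \<union> T. v j)"
      using prod_cube_coords[OF v, of S] prod_cube_coords[OF v, of T]
        prod_cube_coords[OF v, of "S \<union> T"] S monomial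
      by (auto simp: power_add)
  qed
next
  case zero
  then show ?case by (simp add: weighted_poly.zero)
next
  case (add E E')
  then show ?case
    using weighted_poly.add by (fastforce simp: distrib_left)
next
  case (cong E E')
  then show ?case
    by (metis (no_types, lifting) weighted_poly.cong)
qed

lemma weighted_poly_mult:
  assumes "E \<in> weighted_poly q r n d" "E' \<in> weighted_poly q r n e"
  shows "(\<lambda>v. E v * E' v) \<in> weighted_poly q r n (d + e)"
  using assms(1)
proof induction
  case (monomial S t a)
  then show ?case
    using weighted_poly_monomial_mult[OF assms(2)] by blast
next
  case zero
  then show ?case by (simp add: weighted_poly.zero)
next
  case (add E E')
  then show ?case
    using weighted_poly.add by (fastforce simp: distrib_right)
next
  case (cong E E')
  then show ?case
    by (metis (no_types, lifting) weighted_poly.cong)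
qed

lemma weighted_poly_prod:
  assumes "finite A" "\<And>k. k \<in> A \<Longrightarrow> E k \<in> weighted_poly q r n (d k)"
  shows "(\<lambda>v. \<Prod>k\<in>A. E k v) \<in> weighted_poly q r n (\<Sum>k\<in>A. d k)"
  using assms
proof (induction A)
  case empty
  then show ?case by (simp add: weighted_poly_const)
next
  case (insert k A)
  then show ?case
    using weighted_poly_mult[of "E k" q r n "d k"] by simp
qed

section \<open>Finite differences of periodic functions\<close>

definition fdiff :: "(int \<Rightarrow> int) \<Rightarrow> int \<Rightarrow> int" where
  "fdiff u z = u (z + 1) - u z"

text \<open>
  The analogue of \<^const>\<open>weighted_poly\<close> for functions of one integer variable, with derivatives in place
  of coefficients: \<open>q\<^sup>t\<close> divides the \<open>s\<close>-th difference for the least \<open>t\<close> that the weight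
  allows. For \<open>q = 0\<close> and \<open>r > 0\<close> it says that the differences of order greater than \<open>d\<close> vanish.
\<close>
definition diff_order :: "int \<Rightarrow> nat \<Rightarrow> int \<Rightarrow> (int \<Rightarrow> int) \<Rightarrow> bool" where
  "diff_order q r d u \<longleftrightarrow> (\<forall>s. \<exists>t. int s \<le> d + int (t * r) \<and> (\<forall>z. q ^ t dvd (fdiff ^^ s) u z))"

lemma fdiff_iter_diff: "(fdiff ^^ s) (\<lambda>z. u z - w z) = (\<lambda>z. (fdiff ^^ s) u z - (fdiff ^^ s) w z)"
  by (induction s) (auto simp: fdiff_def fun_eq_iff)

lemma fdiff_iter_shift: "(fdiff ^^ s) (\<lambda>z. u (z + h)) = (\<lambda>z. (fdiff ^^ s) u (z + h))"
  by (induction s) (auto simp: fdiff_def fun_eq_iff algebra_simps)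

lemma dvd_translate_of_dvd_fdiff:
  assumes "\<And>z. c dvd fdiff w z"
  shows "c dvd w (z + h) - w z"
proof (induction h rule: int_induct[where k = 0])
  case base
  then show ?case by simp
next
  case (step1 i)
  then show ?case
    using assms[of "z + i"] dvd_add by (fastforce simp: fdiff_def algebra_simps)
next
  case (step2 i)
  then show ?case
    using assms[of "z + i - 1"] dvd_diff by (fastforce simp: fdiff_def algebra_simps)
qed

text \<open>A difference of step \<open>h\<close> is a sum of translates of unit differences, up to sign if \<open>h < 0\<close>.\<close>
lemma diff_order_translate_diff:
  assumes "diff_order q r d u"
  shows "diff_order q r (d - 1) (\<lambda>z. u (z + h) - u z)"
  unfolding diff_order_def
proof
  fix s
  obtain t where t: "int (Suc s) \<le> d + int (t * r)" "\<And>z. q ^ t dvd (fdiff ^^ Suc s) u z"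
    using assms unfolding diff_order_def by metis
  have "q ^ t dvd (fdiff ^^ s) (\<lambda>z. u (z + h) - u z) z" for z
    unfolding fdiff_iter_diff fdiff_iter_shift
    using t(2) by (intro dvd_translate_of_dvd_fdiff) simp
  then show "\<exists>t. int s \<le> d - 1 + int (t * r) \<and>
      (\<forall>z. q ^ t dvd (fdiff ^^ s) (\<lambda>z. u (z + h) - u z) z)"
    using t(1) by (intro exI[of _ t]) auto
qed

text \<open>
  The coefficients of \<open>u\<close> along an affine function on the cube are iterated differences of \<open>u\<close>. The
  induction adds a coordinate \<open>v\<^sub>k\<close> by the identity \<open>u (y + v\<^sub>k h\<^sub>k) = u y + v\<^sub>k (u (y + h\<^sub>k) - u y)\<close>, in which
  the second summand is a factor of degree 1 times a function of degree \<open>d - 1\<close>.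
\<close>
lemma weighted_poly_of_diff_order:
  assumes "A \<subseteq> {..<n}" "diff_order q r d u"
  shows "(\<lambda>v. u (x + (\<Sum>j\<in>A. v j * h j))) \<in> weighted_poly q r n d"
proof -
  have "finite A" using assms finite_subset by blast
  then show ?thesis using assms
  proof (induction A arbitrary: d u)
    case empty
    obtain t where t: "int 0 \<le> d + int (t * r)" "q ^ t dvd u x"
      using empty.prems(2) unfolding diff_order_def by (metis funpow_0)
    then obtain a where "u x = a * q ^ t" by (metis dvd_def mult.commute)
    then show ?case
      using weighted_poly.monomial[of "{}" n d t r a q] t by simp
  next
    case (insert k A)
    let ?L = "\<lambda>v. x + (\<Sum>j\<in>A. v j * h j)"
    have "(\<lambda>v. v k * (u (?L v + h k) - u (?L v))) \<in> weighted_poly q r n (1 + (d - 1))"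
      using insert.prems insert.IH[OF _ diff_order_translate_diff[OF insert.prems(2)]]
      by (intro weighted_poly_mult weighted_poly_coord) auto
    moreover have "(\<lambda>v. u (?L v)) \<in> weighted_poly q r n d"
      using insert by auto
    ultimately have "(\<lambda>v. u (?L v) + v k * (u (?L v + h k) - u (?L v))) \<in> weighted_poly q r n d"
      using weighted_poly.add by fastforce
    then show ?case
    proof (rule weighted_poly.cong)
      fix v assume "v \<in> cube n"
      then have "v k = 0 \<or> v k = 1" using cube_coord insert.prems by auto
      then show "u (x + (\<Sum>j\<in>insert k A. v j * h j))
          = u (?L v) + v k * (u (?L v + h k) - u (?L v))"
        using insert.hyps by (auto simp: algebra_simps)
    qed
  qed
qed

text \<open>The binomial coefficient whose upper entry is an integer, possibly negative.\<close>
definition zbinom :: "int \<Rightarrow> nat \<Rightarrow> int" where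
  "zbinom z a = (\<Prod>i = 0..<a. z - int i) div fact a"

lemma zbinom_Suc_Suc: "zbinom (z + 1) (Suc a) = zbinom z a + zbinom z (Suc a)"
  using gbinomial_int_Suc_Suc[of z a] unfolding gbinomial_prod_rev zbinom_def .

lemma zbinom_mult_fact: "fact a * zbinom z a = (\<Prod>i = 0..<a. z - int i)"
  using gbinomial_int_mult_fact[of a z] unfolding gbinomial_prod_rev zbinom_def .

lemma zbinom_of_nat: "zbinom (int m) a = int (m choose a)"
  using gbinomial_nneg[of "int m" a] unfolding gbinomial_prod_rev zbinom_def by simp

lemma zbinom_0 [simp]: "zbinom z 0 = 1"
  by (simp add: zbinom_def)

lemma fdiff_iter_zbinom:
  "(fdiff ^^ s) (\<lambda>z. zbinom z a) = (if s \<le> a then (\<lambda>z. zbinom z (a - s)) else (\<lambda>z. 0))"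
proof (induction s)
  case (Suc s)
  show ?case
  proof (cases "Suc s \<le> a")
    case True
    then obtain b where "a - s = Suc b" "a - Suc s = b" by (metis Suc_diff_Suc Suc_le_lessD)
    then show ?thesis using Suc True by (auto simp: fdiff_def zbinom_Suc_Suc fun_eq_iff)
  next
    case False
    then show ?thesis using Suc by (cases "s = a") (auto simp: fdiff_def fun_eq_iff)
  qed
qed auto

lemma diff_order_zbinom:
  assumes "r > 0"
  shows "diff_order q r (int a) (\<lambda>z. zbinom z a)"
  unfolding diff_order_def
proof
  fix s
  have "s \<le> s * r" using assms by simp
  then have "int s \<le> int a + int (s * r)" by linarith
  then show "\<exists>t. int s \<le> int a + int (t * r) \<and> (\<forall>z. q ^ t dvd (fdiff ^^ s) (\<lambda>z. zbinom z a) z)"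
    by (cases "s \<le> a") (auto simp: fdiff_iter_zbinom intro: exI[of _ 0] exI[of _ s])
qed

lemma diff_order_identity: "r > 0 \<Longrightarrow> diff_order q r 1 (\<lambda>z. z)"
  using diff_order_zbinom[of r q 1] by (simp add: zbinom_def)

text \<open>Newton's forward difference formula.\<close>
lemma fdiff_binomial_expansion:
  "w (z + int n) = (\<Sum>j\<le>n. int (n choose j) * (fdiff ^^ j) w z)"
proof (induction n arbitrary: w)
  case (Suc n)
  have "w (z + int (Suc n)) = w (z + int n) + fdiff w (z + int n)"
    by (simp add: fdiff_def algebra_simps)
  also have "\<dots> = (\<Sum>j\<le>n. int (n choose j) * (fdiff ^^ j) w z)
      + (\<Sum>j\<le>n. int (n choose j) * (fdiff ^^ Suc j) w z)"
    using Suc[of w] Suc[of "fdiff w"] by (simp del: funpow.simps add: funpow_Suc_right)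
  also have "(\<Sum>j\<le>n. int (n choose j) * (fdiff ^^ j) w z)
      = (\<Sum>j\<le>Suc n. int (n choose j) * (fdiff ^^ j) w z)" by simp
  also have "\<dots> = w z + (\<Sum>j\<le>n. int (n choose Suc j) * (fdiff ^^ Suc j) w z)"
    by (subst sum.atMost_Suc_shift) simp
  finally show ?case
    by (subst sum.atMost_Suc_shift) (simp add: sum.distrib algebra_simps)
qed simp

lemma dvd_fdiff_iter:
  assumes "\<And>z. c dvd w z"
  shows "c dvd (fdiff ^^ s) w z"
  by (induction s arbitrary: z) (auto simp: fdiff_def assms)

text \<open>
  For a \<open>p\<close>-periodic function the forward difference formula for \<open>w (z + p) = w z\<close> expresses the \<open>p\<close>-th
  difference by the differences of order \<open>1, \<dots>, p - 1\<close>, with coefficients \<open>p choose j\<close>, which are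
  divisible by \<open>p\<close>. Thus \<open>p - 1\<close> further differences gain a factor of \<open>p\<close>.
\<close>
lemma dvd_fdiff_periodic:
  fixes p :: nat
  assumes p: "prime p" and per: "\<And>z. w (z + int p) = w z" and c: "\<And>z. c dvd fdiff w z"
  shows "int p * c dvd (fdiff ^^ p) w z"
proof -
  obtain m where m: "p = Suc (Suc m)"
    using prime_ge_2_nat[OF p] by (metis Suc_le_D numeral_2_eq_2 Suc_le_mono)
  have "w z = (\<Sum>j\<le>p. int (p choose j) * (fdiff ^^ j) w z)"
    using fdiff_binomial_expansion[of w z p] per by simp
  also have "\<dots> = (fdiff ^^ p) w z + (w z + (\<Sum>j\<le>m. int (p choose Suc j) * (fdiff ^^ Suc j) w z))"
    unfolding m by (subst sum.atMost_Suc, subst sum.atMost_Suc_shift) simp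
  finally have "(fdiff ^^ p) w z = - (\<Sum>j\<le>m. int (p choose Suc j) * (fdiff ^^ Suc j) w z)"
    by simp
  moreover have "int p * c dvd int (p choose Suc j) * (fdiff ^^ Suc j) w z" if "j \<le> m" for j
  proof (rule mult_dvd_mono)
    show "int p dvd int (p choose Suc j)"
      unfolding of_nat_dvd_iff by (rule dvd_choose_prime) (use that m p in auto)
    show "c dvd (fdiff ^^ Suc j) w z"
      unfolding funpow_Suc_right o_def by (rule dvd_fdiff_iter[OF c])
  qed
  ultimately show ?thesis
    by (simp only: dvd_minus_iff) (auto intro!: dvd_sum simp del: funpow.simps)
qed

text \<open>For \<open>a < p\<close> the polynomial \<open>z choose a\<close> has a denominator prime to \<open>p\<close>, so it is \<open>p\<close>-periodic modulo \<open>p\<close>.\<close>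
lemma zbinom_mod_cong:
  fixes p :: nat
  assumes p: "prime p" and a: "a < p"
  shows "int p dvd zbinom (z mod int p) a - zbinom z a"
proof -
  have "[(\<Prod>i = 0..<a. z mod int p - int i) = (\<Prod>i = 0..<a. z - int i)] (mod int p)"
    by (intro cong_prod cong_diff) auto
  then have "int p dvd fact a * zbinom (z mod int p) a - fact a * zbinom z a"
    by (simp add: zbinom_mult_fact cong_iff_dvd_diff)
  then have "int p dvd fact a * (zbinom (z mod int p) a - zbinom z a)"
    by (simp add: algebra_simps)
  moreover have "\<not> int p dvd fact a"
    using a p by (metis of_nat_fact int_dvd_int_iff prime_dvd_fact_iff not_less)
  ultimately show ?thesis
    using p by (simp add: prime_dvd_mult_iff)
qed

text \<open>
  Up to order \<open>a\<close> nothing is claimed. Modulo \<open>p\<close> the function is a polynomial of degree \<open>a\<close>, which gives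
  the factor \<open>p\<close> for higher orders. From order \<open>a + p\<close> on, periodicity yields one more factor of \<open>p\<close> for
  every \<open>p - 1\<close> orders.
\<close>
lemma diff_order_zbinom_mod:
  fixes p :: nat
  assumes p: "prime p" and a: "a < p"
  shows "diff_order (int p) (p - 1) (int a) (\<lambda>z. zbinom (z mod int p) a)"
  unfolding diff_order_def
proof
  let ?u = "\<lambda>z. zbinom (z mod int p) a"
  have p2: "p \<ge> 2" using p by (rule prime_ge_2_nat)
  fix s
  show "\<exists>t. int s \<le> int a + int (t * (p - 1)) \<and> (\<forall>z. int p ^ t dvd (fdiff ^^ s) ?u z)"
  proof (induction s rule: less_induct)
    case (less s)
    consider "s \<le> a" | "a < s" "s < a + p" | "a + p \<le> s" by linarith
    then show ?case
    proof cases
      case 1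
      then show ?thesis by (intro exI[of _ 0]) auto
    next
      case 2
      have "int p dvd (fdiff ^^ s) (\<lambda>z. ?u z - zbinom z a) z" for z
        using zbinom_mod_cong[OF p a] by (rule dvd_fdiff_iter)
      then have "int p dvd (fdiff ^^ s) ?u z" for z
        using 2 by (simp add: fdiff_iter_diff fdiff_iter_zbinom)
      then show ?thesis using 2 by (intro exI[of _ 1]) auto
    next
      case 3
      define s' where "s' = s - p"
      have s: "s = p + s'" "a \<le> s'" "Suc s' < s" using 3 p2 by (auto simp: s'_def)
      obtain t where t: "int (Suc s') \<le> int a + int (t * (p - 1))"
          "\<And>z. int p ^ t dvd (fdiff ^^ Suc s') ?u z"
        using less[OF s(3)] by blast
      have "(fdiff ^^ s') ?u (z + int p) = (fdiff ^^ s') ?u z" for z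
        using fun_cong[OF fdiff_iter_shift[of s' ?u "int p"], of z] by simp
      then have "int p * int p ^ t dvd (fdiff ^^ p) ((fdiff ^^ s') ?u) z" for z
        using t(2) by (intro dvd_fdiff_periodic p) auto
      then have "int p ^ Suc t dvd (fdiff ^^ s) ?u z" for z
        by (simp add: s funpow_add)
      moreover have "int s \<le> int a + int (Suc t * (p - 1))"
      proof -
        obtain r where "p = Suc r" using p2 by (cases p) auto
        then show ?thesis using t(1) s by simp
      qed
      ultimately show ?thesis by blast
    qed
  qed
qed

section \<open>Host-Kra cubes supported at a corner\<close>

abbreviation face_at :: "nat \<Rightarrow> nat set \<Rightarrow> (nat \<Rightarrow> int) \<Rightarrow> (nat \<Rightarrow> int) set" where
  "face_at n K w \<equiv> {v \<in> cube n. \<forall>j\<in>K. v j = w j}"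

lemma (in group) inv_cancel_left:
  assumes "x \<in> carrier G" "y \<in> carrier G"
  shows "inv x \<otimes> (x \<otimes> y) = y" "x \<otimes> (inv x \<otimes> y) = y"
  using assms by (simp_all add: m_assoc[symmetric])

context filtered_group
begin

lemma F_subset: "g \<in> F i \<Longrightarrow> g \<in> carrier G"
  using filtration_subgroup subgroup.mem_carrier by metis

lemma F_antimono: "i \<le> j \<Longrightarrow> g \<in> F j \<Longrightarrow> g \<in> F i"
  using lift_Suc_antimono_le[of F, OF filtration_decreasing] by blast

lemma F_commutator:
  assumes "g \<in> F i" "h \<in> F j"
  shows "g \<otimes> h \<otimes> inv g \<otimes> inv h \<in> F (i + j)"
proof -
  have "g \<otimes> h \<otimes> inv g \<otimes> inv h \<in> commutator_subgroup G (F i) (F j)"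
    unfolding commutator_subgroup_def using assms by (intro generate.incl) blast
  then show ?thesis using filtration_commutator by blast
qed

abbreviation maps_group :: "nat \<Rightarrow> ((nat \<Rightarrow> int) \<Rightarrow> 'a) monoid" where
  "maps_group n \<equiv> product_group (cube n) (\<lambda>_. G)"

lemma group_maps_group: "group (maps_group n)"
  by (simp add: group_axioms)

text \<open>
  The generators of the Host-Kra group whose face lies in the face \<open>v\<^sub>j = 1\<close>, \<open>j \<in> J\<close>. As \<open>J\<close> grows from
  the empty set to the set of all coordinates, the group they generate shrinks from all cubes to the
  cubes supported at the top vertex with a value in \<open>G\<^sub>n\<close>.
\<close>
definition corner_generators :: "nat \<Rightarrow> nat set \<Rightarrow> ((nat \<Rightarrow> int) \<Rightarrow> 'a) set" where
  "corner_generators n J = {face_element G n g (face_at n K w) | g K w.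
     J \<subseteq> K \<and> K \<subseteq> {..<n} \<and> w \<in> cube n \<and> (\<forall>j\<in>J. w j = 1) \<and> g \<in> F (card K)}"

definition corner_cubes :: "nat \<Rightarrow> nat set \<Rightarrow> ((nat \<Rightarrow> int) \<Rightarrow> 'a) set" where
  "corner_cubes n J = generate (maps_group n) (corner_generators n J)"

lemma host_kra_cubes_eq_corner_cubes: "host_kra_cubes G F n = corner_cubes n {}"
  unfolding host_kra_cubes_def corner_cubes_def corner_generators_def faces_def
  by (rule arg_cong[where f = "generate _"]) blast

lemma corner_generators_subset: "corner_generators n J \<subseteq> carrier (maps_group n)"
  by (auto simp: corner_generators_def face_element_def F_subset)

lemma subgroup_corner_cubes: "subgroup (corner_cubes n J) (maps_group n)"
  unfolding corner_cubes_def
  by (intro group.generate_is_subgroup group_maps_group corner_generators_subset)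

lemma corner_cubes_subset: "corner_cubes n J \<subseteq> cube n \<rightarrow>\<^sub>E carrier G"
  using subgroup.subset[OF subgroup_corner_cubes] by simp

lemma corner_cubes_closed:
  assumes "c \<in> corner_cubes n J" "v \<in> cube n"
  shows "c v \<in> carrier G"
  using assms corner_cubes_subset by (blast intro: PiE_mem)

text \<open>
  With this, elements of \<^const>\<open>corner_cubes\<close> are products of generators, and the induction rule below
  needs no case for inverses.
\<close>
lemma corner_generators_inv:
  assumes "x \<in> corner_generators n J"
  shows "inv\<^bsub>maps_group n\<^esub> x \<in> corner_generators n J"
proof -
  obtain g K w where x: "x = face_element G n g (face_at n K w)" and *: "J \<subseteq> K" "K \<subseteq> {..<n}"
      "w \<in> cube n" "\<forall>j\<in>J. w j = 1" "g \<in> F (card K)"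
    using assms unfolding corner_generators_def by blast
  have "inv\<^bsub>maps_group n\<^esub> x = face_element G n (inv g) (face_at n K w)"
    using * by (subst inv_product_group) (auto simp: x face_element_def F_subset group_axioms fun_eq_iff)
  moreover have "inv g \<in> F (card K)"
    using * filtration_subgroup subgroup.m_inv_closed by metis
  ultimately show ?thesis
    using * unfolding corner_generators_def by blast
qed

lemma corner_cubes_induct [consumes 1, case_names one generator mult]:
  assumes "c \<in> corner_cubes n J"
    and "P \<one>\<^bsub>maps_group n\<^esub>"
    and "\<And>x. x \<in> corner_generators n J \<Longrightarrow> P x"
    and "\<And>x y. \<lbrakk>x \<in> corner_cubes n J; P x; y \<in> corner_cubes n J; P y\<rbrakk> \<Longrightarrow> P (x \<otimes>\<^bsub>maps_group n\<^esub> y)"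
  shows "P c"
  using assms(1) unfolding corner_cubes_def
proof induction
  case (inv h)
  then show ?case by (intro assms corner_generators_inv)
qed (use assms in \<open>auto simp: corner_cubes_def simp del: mult_product_group one_product_group\<close>)

lemma corner_cubes_one: "\<one>\<^bsub>maps_group n\<^esub> \<in> corner_cubes n J"
  unfolding corner_cubes_def by (rule generate.one)

lemma corner_cubes_mult:
  "x \<in> corner_cubes n J \<Longrightarrow> y \<in> corner_cubes n J \<Longrightarrow> x \<otimes>\<^bsub>maps_group n\<^esub> y \<in> corner_cubes n J"
  unfolding corner_cubes_def by (rule generate.eng)

lemma corner_cubes_generator: "x \<in> corner_generators n J \<Longrightarrow> x \<in> corner_cubes n J"
  unfolding corner_cubes_def by (rule generate.incl)

text \<open>A face contained in \<open>v\<^sub>j = 1\<close>, \<open>j \<in> J\<close>, has codimension at least \<open>|J|\<close>.\<close>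
lemma corner_cubes_value:
  assumes "c \<in> corner_cubes n J" "v \<in> cube n" "J \<subseteq> {..<n}"
  shows "c v \<in> F (card J)"
  using assms(1)
proof (induction rule: corner_cubes_induct)
  case one
  then show ?case using assms filtration_subgroup subgroup.one_closed by fastforce
next
  case (generator x)
  then obtain g K w where x: "x = face_element G n g (face_at n K w)" and *: "J \<subseteq> K" "K \<subseteq> {..<n}"
      "g \<in> F (card K)"
    unfolding corner_generators_def by blast
  then have "card J \<le> card K" by (meson card_mono finite_lessThan finite_subset)
  then have "g \<in> F (card J)" using * F_antimono by blast
  then show ?case
    using assms filtration_subgroup subgroup.one_closed by (fastforce simp: x face_element_def)
next
  case (mult x y)
  then show ?case
    using assms filtration_subgroup subgroup.m_closed by (fastforce)
qed

text \<open>
  The commutator of two generators is supported on the intersection of their faces. If this is not empty,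
  it is a face whose codimension is at most the sum of the two codimensions, and the commutator axiom
  of the filtration applies.
\<close>
lemma corner_generators_commutator:
  assumes x: "x \<in> corner_generators n J" and y: "y \<in> corner_generators n J'"
  shows "\<exists>z \<in> corner_cubes n J'. x \<otimes>\<^bsub>maps_group n\<^esub> y \<otimes>\<^bsub>maps_group n\<^esub> inv\<^bsub>maps_group n\<^esub> x
            = z \<otimes>\<^bsub>maps_group n\<^esub> y"
proof -
  obtain g K w where xe: "x = face_element G n g (face_at n K w)" and g: "J \<subseteq> K" "K \<subseteq> {..<n}"
      "w \<in> cube n" "\<forall>j\<in>J. w j = 1" "g \<in> F (card K)"
    using x unfolding corner_generators_def by blast
  obtain h L u where ye: "y = face_element G n h (face_at n L u)" and h: "J' \<subseteq> L" "L \<subseteq> {..<n}"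
      "u \<in> cube n" "\<forall>j\<in>J'. u j = 1" "h \<in> F (card L)"
    using y unfolding corner_generators_def by blast
  have gh: "g \<in> carrier G" "h \<in> carrier G" using g h F_subset by auto
  define z where "z = face_element G n (g \<otimes> h \<otimes> inv g \<otimes> inv h) (face_at n K w \<inter> face_at n L u)"
  have "x \<otimes>\<^bsub>maps_group n\<^esub> y \<otimes>\<^bsub>maps_group n\<^esub> inv\<^bsub>maps_group n\<^esub> x = z \<otimes>\<^bsub>maps_group n\<^esub> y"
    unfolding xe ye z_def using gh
    by (subst inv_product_group)
      (auto simp: face_element_def group_axioms fun_eq_iff m_assoc r_inv l_inv)
  moreover have "z \<in> corner_cubes n J'"
  proof (cases "face_at n K w \<inter> face_at n L u = {}")
    case True
    then have "z = \<one>\<^bsub>maps_group n\<^esub>" by (auto simp: z_def face_element_def fun_eq_iff)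
    then show ?thesis by (simp only: corner_cubes_one)
  next
    case False
    then obtain s where s: "s \<in> cube n" "\<forall>j\<in>K. s j = w j" "\<forall>j\<in>L. s j = u j" by blast
    have "card (K \<union> L) \<le> card K + card L" by (rule card_Un_le)
    then have "g \<otimes> h \<otimes> inv g \<otimes> inv h \<in> F (card (K \<union> L))"
      using F_commutator F_antimono g h by blast
    moreover have "face_at n K w \<inter> face_at n L u = face_at n (K \<union> L) s"
      using s by auto
    ultimately have "z \<in> corner_generators n J'"
      unfolding z_def corner_generators_def using s g h
      by (intro CollectI exI[of _ "g \<otimes> h \<otimes> inv g \<otimes> inv h"] exI[of _ "K \<union> L"] exI[of _ s]) auto
    then show ?thesis by (rule corner_cubes_generator)
  qed
  ultimately show ?thesis by blast
qed

lemma corner_cubes_conj: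
  assumes "c \<in> corner_cubes n J" "d \<in> corner_cubes n J'"
  shows "c \<otimes>\<^bsub>maps_group n\<^esub> d \<otimes>\<^bsub>maps_group n\<^esub> inv\<^bsub>maps_group n\<^esub> c \<in> corner_cubes n J'"
proof -
  interpret P: group "maps_group n" by (rule group_maps_group)
  have in_carrier: "\<And>x J. x \<in> corner_cubes n J \<Longrightarrow> x \<in> carrier (maps_group n)"
    using corner_cubes_subset by auto
  note [simp del] = mult_product_group one_product_group carrier_product_group inv_product_group
  have gen: "x \<otimes>\<^bsub>maps_group n\<^esub> d \<otimes>\<^bsub>maps_group n\<^esub> inv\<^bsub>maps_group n\<^esub> x \<in> corner_cubes n J'"
    if x: "x \<in> corner_generators n J" and "d \<in> corner_cubes n J'" for x d
    using that(2)
  proof (induction rule: corner_cubes_induct)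
    case one
    then show ?case using x corner_generators_subset[of n J] by (auto simp: P.r_inv corner_cubes_one)
  next
    case (generator y)
    then show ?case
      using corner_generators_commutator[OF x generator] corner_cubes_mult corner_cubes_generator by metis
  next
    case (mult a b)
    have "x \<in> carrier (maps_group n)" using x corner_generators_subset by blast
    then have "x \<otimes>\<^bsub>maps_group n\<^esub> (a \<otimes>\<^bsub>maps_group n\<^esub> b) \<otimes>\<^bsub>maps_group n\<^esub> inv\<^bsub>maps_group n\<^esub> x
       = (x \<otimes>\<^bsub>maps_group n\<^esub> a \<otimes>\<^bsub>maps_group n\<^esub> inv\<^bsub>maps_group n\<^esub> x)
         \<otimes>\<^bsub>maps_group n\<^esub> (x \<otimes>\<^bsub>maps_group n\<^esub> b \<otimes>\<^bsub>maps_group n\<^esub> inv\<^bsub>maps_group n\<^esub> x)"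
      using in_carrier[OF \<open>a \<in> corner_cubes n J'\<close>] in_carrier[OF \<open>b \<in> corner_cubes n J'\<close>]
      by (simp add: P.m_assoc P.inv_cancel_left)
    then show ?case using mult corner_cubes_mult by simp
  qed
  show ?thesis using assms
  proof (induction arbitrary: d rule: corner_cubes_induct)
    case one
    then show ?case using in_carrier by simp
  next
    case (generator x)
    then show ?case by (rule gen)
  next
    case (mult a b)
    have "(a \<otimes>\<^bsub>maps_group n\<^esub> b) \<otimes>\<^bsub>maps_group n\<^esub> d \<otimes>\<^bsub>maps_group n\<^esub> inv\<^bsub>maps_group n\<^esub> (a \<otimes>\<^bsub>maps_group n\<^esub> b)
      = a \<otimes>\<^bsub>maps_group n\<^esub> (b \<otimes>\<^bsub>maps_group n\<^esub> d \<otimes>\<^bsub>maps_group n\<^esub> inv\<^bsub>maps_group n\<^esub> b) \<otimes>\<^bsub>maps_group n\<^esub> inv\<^bsub>maps_group n\<^esub> a"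
      using in_carrier[OF \<open>a \<in> corner_cubes n J\<close>] in_carrier[OF \<open>b \<in> corner_cubes n J\<close>]
        in_carrier[OF \<open>d \<in> corner_cubes n J'\<close>]
      by (simp add: P.m_assoc P.inv_mult_group)
    then show ?case using mult by simp
  qed
qed

text \<open>
  A generator either is independent of coordinate \<open>a\<close>, or lives on \<open>v\<^sub>a = 1\<close>, or lives on
  \<open>v\<^sub>a = 0\<close>; in the last case its face is the difference of a face independent of \<open>v\<^sub>a\<close> and one on which
  \<open>v\<^sub>a = 1\<close>. Products are put in this form with the help of \<open>corner_cubes_conj\<close>.
\<close>
lemma corner_cubes_split:
  assumes "c \<in> corner_cubes n J" "J \<subseteq> {..<n}" "a < n" "a \<notin> J"
  shows "\<exists>b \<in> corner_cubes n J. \<exists>d \<in> corner_cubes n (insert a J).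
     c = b \<otimes>\<^bsub>maps_group n\<^esub> d \<and> (\<forall>v \<in> cube n. b v = b (v(a := 0)))"
  using assms(1)
proof (induction rule: corner_cubes_induct)
  case one
  have "\<one>\<^bsub>maps_group n\<^esub> = \<one>\<^bsub>maps_group n\<^esub> \<otimes>\<^bsub>maps_group n\<^esub> \<one>\<^bsub>maps_group n\<^esub>"
    by (auto simp: fun_eq_iff)
  moreover have "\<forall>v \<in> cube n. \<one>\<^bsub>maps_group n\<^esub> v = \<one>\<^bsub>maps_group n\<^esub> (v(a := 0))"
    using fun_upd_in_cube[OF _ \<open>a < n\<close>, of _ 0] by simp
  ultimately show ?case using corner_cubes_one by metis
next
  case (generator x)
  then obtain g K w where x: "x = face_element G n g (face_at n K w)" and g: "J \<subseteq> K" "K \<subseteq> {..<n}"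
      "w \<in> cube n" "\<forall>j\<in>J. w j = 1" "g \<in> F (card K)"
    unfolding corner_generators_def by blast
  have gc: "g \<in> carrier G" using g F_subset by auto
  have upd: "v(a := 0) \<in> cube n" if "v \<in> cube n" for v
    using fun_upd_in_cube[OF that \<open>a < n\<close>] by simp
  show ?case
  proof (cases "a \<in> K")
    case False
    then have "v(a := 0) \<in> face_at n K w \<longleftrightarrow> v \<in> face_at n K w" if "v \<in> cube n" for v
      using that upd by auto
    then have "\<forall>v \<in> cube n. x v = x (v(a := 0))" using upd by (auto simp: x face_element_def)
    moreover have "x = x \<otimes>\<^bsub>maps_group n\<^esub> \<one>\<^bsub>maps_group n\<^esub>"
      using gc by (auto simp: x face_element_def fun_eq_iff)
    ultimately show ?thesis
      using corner_cubes_generator[OF generator] corner_cubes_one by metis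
  next
    case True
    show ?thesis
    proof (cases "w a = 1")
      case True
      then have "x \<in> corner_generators n (insert a J)"
        using g \<open>a \<in> K\<close> unfolding x corner_generators_def by blast
      then have "x \<in> corner_cubes n (insert a J)" by (rule corner_cubes_generator)
      moreover have "x = \<one>\<^bsub>maps_group n\<^esub> \<otimes>\<^bsub>maps_group n\<^esub> x"
        using gc by (auto simp: x face_element_def fun_eq_iff)
      moreover have "\<forall>v \<in> cube n. \<one>\<^bsub>maps_group n\<^esub> v = \<one>\<^bsub>maps_group n\<^esub> (v(a := 0))"
        using upd by simp
      ultimately show ?thesis using corner_cubes_one by metis
    next
      case False
      then have wa: "w a = 0" using g(3) \<open>a < n\<close> cube_coord by blast
      define b where "b = face_element G n g (face_at n (K - {a}) w)"
      define d where "d = face_element G n (inv g) (face_at n K (w(a := 1)))"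
      have "card (K - {a}) \<le> card K" by (simp add: card_Diff1_le)
      then have "g \<in> F (card (K - {a}))" using g F_antimono by blast
      then have b: "b \<in> corner_generators n J"
        using g \<open>a \<notin> J\<close> unfolding b_def corner_generators_def by blast
      have "inv g \<in> F (card K)" using g filtration_subgroup subgroup.m_inv_closed by metis
      moreover have "w(a := 1) \<in> cube n" using fun_upd_in_cube[OF g(3) \<open>a < n\<close>] by simp
      ultimately have d: "d \<in> corner_generators n (insert a J)"
        using g \<open>a \<in> K\<close> unfolding d_def corner_generators_def
        by (intro CollectI exI[of _ "inv g"] exI[of _ K] exI[of _ "w(a := 1)"]) auto
      have "x v = b v \<otimes> d v" if v: "v \<in> cube n" for v
      proof -
        have "v a = 0 \<or> v a = 1" using v \<open>a < n\<close> by (rule cube_coord)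
        moreover have "v \<in> face_at n K w \<longleftrightarrow> v \<in> face_at n (K - {a}) w \<and> v a = 0"
          using wa \<open>a \<in> K\<close> by auto
        moreover have "v \<in> face_at n K (w(a := 1)) \<longleftrightarrow> v \<in> face_at n (K - {a}) w \<and> v a = 1"
          using \<open>a \<in> K\<close> by auto
        ultimately show ?thesis
          using v gc by (auto simp only: x b_def d_def face_element_def restrict_apply if_True
              if_False l_one r_one inv_closed r_inv one_closed simp_thms split: if_split)
      qed
      then have "x = b \<otimes>\<^bsub>maps_group n\<^esub> d"
        by (auto simp: fun_eq_iff x face_element_def)
      moreover have "\<forall>v \<in> cube n. b v = b (v(a := 0))"
        using upd by (auto simp: b_def face_element_def)
      ultimately show ?thesis using b d corner_cubes_generator by blast
    qed
  qed
next
  case (mult x y)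
  interpret P: group "maps_group n" by (rule group_maps_group)
  obtain b d where bd: "b \<in> corner_cubes n J" "d \<in> corner_cubes n (insert a J)"
      "x = b \<otimes>\<^bsub>maps_group n\<^esub> d" "\<forall>v \<in> cube n. b v = b (v(a := 0))"
    using mult by blast
  obtain b' d' where bd': "b' \<in> corner_cubes n J" "d' \<in> corner_cubes n (insert a J)"
      "y = b' \<otimes>\<^bsub>maps_group n\<^esub> d'" "\<forall>v \<in> cube n. b' v = b' (v(a := 0))"
    using mult by blast
  have in_carrier: "\<And>x J. x \<in> corner_cubes n J \<Longrightarrow> x \<in> carrier (maps_group n)"
    using corner_cubes_subset by auto
  define e where "e = inv\<^bsub>maps_group n\<^esub> b' \<otimes>\<^bsub>maps_group n\<^esub> d \<otimes>\<^bsub>maps_group n\<^esub> inv\<^bsub>maps_group n\<^esub> (inv\<^bsub>maps_group n\<^esub> b')"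
  have "inv\<^bsub>maps_group n\<^esub> b' \<in> corner_cubes n J"
    using bd' subgroup_corner_cubes subgroup.m_inv_closed by metis
  then have e: "e \<in> corner_cubes n (insert a J)"
    unfolding e_def using bd(2) by (rule corner_cubes_conj)
  show ?case
  proof (intro bexI conjI)
    show "x \<otimes>\<^bsub>maps_group n\<^esub> y = (b \<otimes>\<^bsub>maps_group n\<^esub> b') \<otimes>\<^bsub>maps_group n\<^esub> (e \<otimes>\<^bsub>maps_group n\<^esub> d')"
      unfolding e_def bd(3) bd'(3)
      using in_carrier[OF bd(1)] in_carrier[OF bd(2)] in_carrier[OF bd'(1)] in_carrier[OF bd'(2)]
      by (simp add: P.m_assoc P.inv_cancel_left
          del: mult_product_group one_product_group carrier_product_group inv_product_group)
    show "\<forall>v \<in> cube n. (b \<otimes>\<^bsub>maps_group n\<^esub> b') v = (b \<otimes>\<^bsub>maps_group n\<^esub> b') (v(a := 0))"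
    proof
      fix v assume v: "v \<in> cube n"
      then have "v(a := 0) \<in> cube n" using fun_upd_in_cube[OF _ \<open>a < n\<close>] by simp
      then show "(b \<otimes>\<^bsub>maps_group n\<^esub> b') v = (b \<otimes>\<^bsub>maps_group n\<^esub> b') (v(a := 0))"
        using v by (simp add: bspec[OF bd(4) v, symmetric] bspec[OF bd'(4) v, symmetric])
    qed
    show "e \<otimes>\<^bsub>maps_group n\<^esub> d' \<in> corner_cubes n (insert a J)"
      using e bd'(2) by (rule corner_cubes_mult)
    show "b \<otimes>\<^bsub>maps_group n\<^esub> b' \<in> corner_cubes n J"
      using bd(1) bd'(1) by (rule corner_cubes_mult)
  qed
qed

lemma corner_cubes_support:
  assumes "c \<in> corner_cubes n J" "v \<in> cube n" "j \<in> J" "v j \<noteq> 1"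
  shows "c v = \<one>"
  using assms(1)
proof (induction rule: corner_cubes_induct)
  case (generator x)
  then obtain g K w where x: "x = face_element G n g (face_at n K w)" "J \<subseteq> K" "\<forall>j\<in>J. w j = 1"
    unfolding corner_generators_def by blast
  then have "j \<in> K" "w j = 1" using \<open>j \<in> J\<close> by auto
  then have "v \<notin> face_at n K w" using \<open>v j \<noteq> 1\<close> by force
  then show ?case unfolding x face_element_def restrict_apply using \<open>v \<in> cube n\<close> by (simp only: if_False if_True)
qed (use assms in auto)

text \<open>
  If \<open>c = b d\<close> is split along \<open>a\<close>, then on \<open>v\<^sub>a = 0\<close> both \<open>c\<close> and \<open>d\<close> are trivial, hence so is \<open>b\<close>,
  which does not depend on \<open>v\<^sub>a\<close> and is therefore trivial everywhere.
\<close>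
lemma corner_cubes_insert:
  assumes "c \<in> corner_cubes n J" "J \<subseteq> {..<n}" "a < n" "a \<notin> J"
    and trivial: "\<And>v. v \<in> cube n \<Longrightarrow> v a = 0 \<Longrightarrow> c v = \<one>"
  shows "c \<in> corner_cubes n (insert a J)"
proof -
  obtain b d where bd: "b \<in> corner_cubes n J" "d \<in> corner_cubes n (insert a J)"
      "c = b \<otimes>\<^bsub>maps_group n\<^esub> d" "\<forall>v \<in> cube n. b v = b (v(a := 0))"
    using corner_cubes_split[OF assms(1-4)] by blast
  have "b v = \<one>" if "v \<in> cube n" for v
  proof -
    have upd: "v(a := 0) \<in> cube n" using fun_upd_in_cube[OF that \<open>a < n\<close>] by simp
    then have "b (v(a := 0)) \<otimes> d (v(a := 0)) = \<one>" using trivial[OF upd] bd(3) by simp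
    moreover have "d (v(a := 0)) = \<one>" using corner_cubes_support[OF bd(2) upd, of a] by simp
    ultimately show ?thesis
      using corner_cubes_closed[OF bd(1) upd] bd(4) that by simp
  qed
  then have "c v = d v" if "v \<in> cube n" for v
    using that bd corner_cubes_closed[OF bd(2) that] by simp
  then have "c = d"
    using bd assms(1) corner_cubes_subset by (metis (no_types, lifting) PiE_ext subsetD)
  then show ?thesis using bd by simp
qed

lemma corner_cubes_of_support:
  assumes "c \<in> corner_cubes n {}" "J \<subseteq> {..<n}"
    and trivial: "\<And>v j. v \<in> cube n \<Longrightarrow> j \<in> J \<Longrightarrow> v j = 0 \<Longrightarrow> c v = \<one>"
  shows "c \<in> corner_cubes n J"
proof -
  have "finite J" using assms(2) finite_subset by blast
  then show ?thesis using assms(2,3)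
  proof (induction J)
    case (insert a J)
    then show ?case by (intro corner_cubes_insert) auto
  qed (use assms in simp)
qed

section \<open>Operations on Host-Kra cubes\<close>

text \<open>
  Membership in the Host-Kra group for functions whose values outside the cube are irrelevant.
\<close>
definition is_cube :: "nat \<Rightarrow> ((nat \<Rightarrow> int) \<Rightarrow> 'a) \<Rightarrow> bool" where
  "is_cube n c \<longleftrightarrow> restrict c (cube n) \<in> host_kra_cubes G F n"

lemma is_cube_cong:
  assumes "is_cube n c" "\<And>v. v \<in> cube n \<Longrightarrow> c' v = c v"
  shows "is_cube n c'"
proof -
  have "restrict c (cube n) = restrict c' (cube n)" using assms(2) by (intro restrict_ext) simp
  then show ?thesis using assms(1) by (simp add: is_cube_def)
qed

lemma is_cube_of_mem: "c \<in> host_kra_cubes G F n \<Longrightarrow> is_cube n c"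
  unfolding is_cube_def host_kra_cubes_eq_corner_cubes
  using corner_cubes_subset by (metis (no_types, lifting) PiE_restrict subsetD)

lemma is_cube_closed: "is_cube n c \<Longrightarrow> v \<in> cube n \<Longrightarrow> c v \<in> carrier G"
  unfolding is_cube_def host_kra_cubes_eq_corner_cubes
  by (drule corner_cubes_closed) auto

lemma is_cube_one: "is_cube n (\<lambda>v. \<one>)"
  using corner_cubes_one[of n "{}"] by (simp add: is_cube_def host_kra_cubes_eq_corner_cubes)

lemma is_cube_mult:
  assumes "is_cube n c" "is_cube n d"
  shows "is_cube n (\<lambda>v. c v \<otimes> d v)"
proof -
  have "restrict c (cube n) \<otimes>\<^bsub>maps_group n\<^esub> restrict d (cube n) \<in> corner_cubes n {}"
    using assms unfolding is_cube_def host_kra_cubes_eq_corner_cubes by (rule corner_cubes_mult)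
  moreover have "restrict c (cube n) \<otimes>\<^bsub>maps_group n\<^esub> restrict d (cube n)
      = restrict (\<lambda>v. c v \<otimes> d v) (cube n)"
    by (auto simp: fun_eq_iff)
  ultimately show ?thesis
    unfolding is_cube_def host_kra_cubes_eq_corner_cubes by (simp only:)
qed

lemma is_cube_inv:
  assumes "is_cube n c"
  shows "is_cube n (\<lambda>v. inv (c v))"
proof -
  have "inv\<^bsub>maps_group n\<^esub> (restrict c (cube n)) \<in> corner_cubes n {}"
    using assms unfolding is_cube_def host_kra_cubes_eq_corner_cubes
    by (rule subgroup.m_inv_closed[OF subgroup_corner_cubes])
  moreover have "inv\<^bsub>maps_group n\<^esub> (restrict c (cube n)) = restrict (\<lambda>v. inv (c v)) (cube n)"
    using is_cube_closed[OF assms] by (subst inv_product_group) (auto simp: fun_eq_iff group_axioms)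
  ultimately show ?thesis
    unfolding is_cube_def host_kra_cubes_eq_corner_cubes by (simp only:)
qed

lemma is_cube_face:
  assumes "K \<subseteq> {..<n}" "w \<in> cube n" "g \<in> F k" "card K \<le> k"
  shows "is_cube n (\<lambda>v. if \<forall>j\<in>K. v j = w j then g else \<one>)"
proof -
  have "g \<in> F (card K)" using assms F_antimono by blast
  then have "face_element G n g (face_at n K w) \<in> corner_generators n {}"
    unfolding corner_generators_def using assms by blast
  moreover have "face_element G n g (face_at n K w)
      = restrict (\<lambda>v. if \<forall>j\<in>K. v j = w j then g else \<one>) (cube n)"
    by (auto simp: face_element_def fun_eq_iff)
  ultimately show ?thesis
    unfolding is_cube_def host_kra_cubes_eq_corner_cubes by (simp add: corner_cubes_generator)
qed

lemma is_cube_const: "g \<in> carrier G \<Longrightarrow> is_cube n (\<lambda>v. g)"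
  using is_cube_face[of "{}" n "cube_top n" g 0] cube_top_in_cube filtration_0 by simp

text \<open>
  A monomial \<open>a q\<^sup>t \<Prod>\<^bsub>j\<in>S\<^esub> v\<^sub>j\<close> in the exponent puts a power of an element of \<open>G\<^bsub>k+tr\<^esub>\<close> on the face
  \<open>v\<^sub>j = 1\<close>, \<open>j \<in> S\<close>, whose codimension is \<open>|S| \<le> k + t r\<close>.
\<close>
lemma is_cube_pow_weighted_poly:
  assumes gc: "g \<in> carrier G" and g: "\<And>t. g [^] (q ^ t) \<in> F (k + t * r)"
    and E: "E \<in> weighted_poly q r n (int k)"
  shows "is_cube n (\<lambda>v. g [^] (E v))"
  using E
proof induction
  case (monomial S t a)
  define h where "h = (g [^] (q ^ t)) [^] a"
  have "h \<in> F (k + t * r)"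
    unfolding h_def using g[of t] filtration_subgroup subgroup_int_pow_closed by blast
  moreover have "card S \<le> k + t * r" using monomial by linarith
  ultimately have "is_cube n (\<lambda>v. if \<forall>j\<in>S. v j = cube_top n j then h else \<one>)"
    using monomial cube_top_in_cube is_cube_face by blast
  moreover have "g [^] (a * q ^ t * (\<Prod>j\<in>S. v j)) = (if \<forall>j\<in>S. v j = cube_top n j then h else \<one>)"
    if "v \<in> cube n" for v
  proof -
    have "(\<forall>j\<in>S. v j = cube_top n j) \<longleftrightarrow> (\<forall>j\<in>S. v j = 1)"
      using monomial(1) by (auto simp: cube_top_def)
    then show ?thesis
      unfolding prod_cube_coords[OF that monomial(1)] h_def
      using gc by (simp add: int_pow_pow mult.commute)
  qed
  ultimately show ?case by (rule is_cube_cong)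
next
  case zero
  then show ?case by (simp add: is_cube_one)
next
  case (add E E')
  then show ?case using is_cube_mult gc by (fastforce simp: int_pow_mult)
next
  case (cong E E')
  show ?case by (rule is_cube_cong[OF cong.IH]) (simp add: cong.hyps)
qed

lemma is_cube_pullback:
  assumes \<phi>: "coordinatewise m n \<phi>" and "is_cube n c"
  shows "is_cube m (\<lambda>v. c (\<phi> v))"
proof -
  have \<phi>': "\<And>v. v \<in> cube m \<Longrightarrow> \<phi> v \<in> cube n" using \<phi> unfolding coordinatewise_def by blast
  have "is_cube m (\<lambda>v. c (\<phi> v))" if "c \<in> corner_cubes n {}" for c
    using that
  proof (induction rule: corner_cubes_induct)
    case one
    show ?case by (rule is_cube_cong[OF is_cube_one]) (simp add: \<phi>')
  next
    case (generator x)
    then obtain g K w where x: "x = face_element G n g (face_at n K w)" and *: "K \<subseteq> {..<n}"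
        "w \<in> cube n" "g \<in> F (card K)"
      unfolding corner_generators_def by blast
    show ?case
    proof (cases "\<exists>u\<in>cube m. \<phi> u \<in> face_at n K w")
      case True
      then obtain u where u: "u \<in> cube m" "\<forall>j\<in>K. \<phi> u j = w j" by blast
      obtain L where L: "L \<subseteq> {..<m}" "card L \<le> card K"
          "\<forall>v\<in>cube m. (\<forall>j\<in>K. \<phi> v j = \<phi> u j) \<longleftrightarrow> (\<forall>l\<in>L. v l = u l)"
        using coordinatewise_vimage_face[OF \<phi> *(1) u(1)] by blast
      have "is_cube m (\<lambda>v. if \<forall>l\<in>L. v l = u l then g else \<one>)"
        using is_cube_face L u * by blast
      moreover have "x (\<phi> v) = (if \<forall>l\<in>L. v l = u l then g else \<one>)" if "v \<in> cube m" for v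
        using L(3) u(2) that \<phi>' by (auto simp: x face_element_def)
      ultimately show ?thesis by (rule is_cube_cong)
    next
      case False
      then have "x (\<phi> v) = \<one>" if "v \<in> cube m" for v
        using that \<phi>' by (auto simp: x face_element_def)
      then show ?thesis by (rule is_cube_cong[OF is_cube_one])
    qed
  next
    case (mult x y)
    then have "is_cube m (\<lambda>v. x (\<phi> v) \<otimes> y (\<phi> v))" by (intro is_cube_mult)
    then show ?case by (rule is_cube_cong) (simp add: \<phi>')
  qed
  then have "is_cube m (\<lambda>v. restrict c (cube n) (\<phi> v))"
    using assms unfolding is_cube_def host_kra_cubes_eq_corner_cubes by blast
  then show ?thesis by (rule is_cube_cong) (simp add: \<phi>')
qed

text \<open>
  Triviality off the top vertex moves \<open>c\<close> into the group generated by the top vertex alone.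
\<close>
lemma is_cube_top_value:
  assumes c: "is_cube n c" and trivial: "\<And>v. v \<in> cube n \<Longrightarrow> v \<noteq> cube_top n \<Longrightarrow> c v = \<one>"
  shows "c (cube_top n) \<in> F n"
proof -
  have "restrict c (cube n) \<in> corner_cubes n {..<n}"
    using c unfolding is_cube_def host_kra_cubes_eq_corner_cubes
  proof (rule corner_cubes_of_support)
    fix v j assume "v \<in> cube n" "j \<in> {..<n}" "v j = 0"
    then have "v j \<noteq> cube_top n j" by (simp add: cube_top_def)
    then show "restrict c (cube n) v = \<one>"
      using trivial \<open>v \<in> cube n\<close> by auto
  qed auto
  then show ?thesis using corner_cubes_value[of _ n "{..<n}" "cube_top n"] cube_top_in_cube by force
qed

section \<open>Group nilspaces are nilspaces\<close>

lemma mem_cubes_iff: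
  "restrict c (cube n) \<in> cubes (group_nilspace G F) n \<longleftrightarrow> is_cube n c"
  by (simp add: group_nilspace_def is_cube_def)

text \<open>
  Instead of completing the corner \<open>c'\<close> at once, it is matched on the faces \<open>v\<^sub>j = 0\<close>, \<open>j < k\<close>, for
  increasing \<open>k\<close>. The error \<open>e\<^sup>-\<^sup>1 c'\<close> on the next face \<open>v\<^sub>k = 0\<close>, extended constantly in the direction \<open>k\<close>,
  is a cube, and it is trivial on the faces matched before, as these are stable under setting \<open>v\<^sub>k\<close> to \<open>0\<close>.
\<close>
lemma completion_is_cube:
  assumes c': "\<And>v. v \<in> cube (Suc n) \<Longrightarrow> v \<noteq> cube_top (Suc n) \<Longrightarrow> c' v \<in> carrier G"
    and faces: "\<And>i. i < Suc n \<Longrightarrow> is_cube n (\<lambda>v. c' (insert_zero n i v))"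
    and "k \<le> Suc n"
  shows "\<exists>e. is_cube (Suc n) e \<and> (\<forall>v\<in>cube (Suc n). (\<exists>j<k. v j = 0) \<longrightarrow> e v = c' v)"
  using assms(3)
proof (induction k)
  case 0
  then show ?case using is_cube_one by auto
next
  case (Suc k)
  then obtain e where e: "is_cube (Suc n) e" "\<And>v j. v \<in> cube (Suc n) \<Longrightarrow> j < k \<Longrightarrow> v j = 0 \<Longrightarrow> e v = c' v"
    by auto
  have k: "k < Suc n" using Suc by simp
  have reset: "v(k := 0) \<in> cube (Suc n)" "c' (v(k := 0)) \<in> carrier G" if "v \<in> cube (Suc n)" for v
  proof -
    show u: "v(k := 0) \<in> cube (Suc n)" using fun_upd_in_cube[OF that k] by simp
    have "(v(k := 0)) k \<noteq> cube_top (Suc n) k" using k by (simp add: cube_top_def)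
    then show "c' (v(k := 0)) \<in> carrier G" using c'[OF u] by metis
  qed
  have "is_cube (Suc n) (\<lambda>v. c' (v(k := 0)))"
    by (rule is_cube_cong[OF is_cube_pullback[OF coordinatewise_delete_coord[of n k] faces[OF k]]])
      (simp add: insert_zero_delete_coord[OF _ k])
  then have "is_cube (Suc n) (\<lambda>v. e v \<otimes> (inv (e (v(k := 0))) \<otimes> c' (v(k := 0))))"
    using e is_cube_pullback[OF coordinatewise_reset[OF k]]
    by (intro is_cube_mult is_cube_inv) auto
  moreover have "e v \<otimes> (inv (e (v(k := 0))) \<otimes> c' (v(k := 0))) = c' v"
    if v: "v \<in> cube (Suc n)" and j: "j < Suc k" "v j = 0" for v j
  proof (cases "v k = 0")
    case True
    then have "v(k := 0) = v" by auto
    then show ?thesis using reset[OF v] is_cube_closed[OF e(1) v] by (simp add: m_assoc[symmetric] r_inv)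
  next
    case False
    then have "j < k" using j by (metis less_antisym)
    moreover have "(v(k := 0)) j = 0" using j by simp
    ultimately have "e (v(k := 0)) = c' (v(k := 0))" "e v = c' v"
      using e(2) reset(1)[OF v] v j by blast+
    then show ?thesis using reset(2)[OF v] is_cube_closed[OF e(1) v] by (simp add: l_inv)
  qed
  ultimately show ?case by blast
qed

text \<open>On the interval \<open>c\<close> is the constant \<open>c 0\<close> times an element supported at \<open>1\<close>, and \<open>G\<^sub>0 = G\<^sub>1 = G\<close>.\<close>
lemma is_cube_1:
  assumes "\<And>v. v \<in> cube 1 \<Longrightarrow> c v \<in> carrier G"
  shows "is_cube 1 c"
proof -
  let ?t = "cube_top 1" let ?z = "(cube_top 1)(0 := 0)"
  have tz: "?t \<in> cube 1" "?z \<in> cube 1" using cube_top_in_cube fun_upd_in_cube by auto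
  define g where "g = inv (c ?z) \<otimes> c ?t"
  have "g \<in> F 1" using assms tz filtration_1 by (simp add: g_def)
  then have "is_cube 1 (\<lambda>v. if \<forall>j\<in>{0}. v j = ?t j then g else \<one>)"
    using is_cube_face[of "{0}" 1 ?t g 1] tz(1) by simp
  then have "is_cube 1 (\<lambda>v. c ?z \<otimes> (if \<forall>j\<in>{0}. v j = ?t j then g else \<one>))"
    using assms tz by (intro is_cube_mult is_cube_const) auto
  moreover have "c v = c ?z \<otimes> (if \<forall>j\<in>{0}. v j = ?t j then g else \<one>)" if v: "v \<in> cube 1" for v
  proof (cases "v 0 = 1")
    case True
    then have "v = ?t" using v by (intro cube_eq_topI) auto
    then show ?thesis using assms tz by (simp add: g_def m_assoc[symmetric] r_inv)
  next
    case False
    then have "v = ?z" using v tz cube_coord[OF v, of 0] by (intro cube_eqI) auto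
    then show ?thesis using assms tz by (simp add: cube_top_def)
  qed
  ultimately show ?thesis by (rule is_cube_cong)
qed

lemma nilspace_group_nilspace: "nilspace (group_nilspace G F)"
proof
  show sub: "cubes (group_nilspace G F) n \<subseteq> cube n \<rightarrow>\<^sub>E points (group_nilspace G F)" for n
    using corner_cubes_subset by (simp add: group_nilspace_def host_kra_cubes_eq_corner_cubes)
  show "compose (cube m) c \<phi> \<in> cubes (group_nilspace G F) m"
    if "c \<in> cubes (group_nilspace G F) n" "cube_morphism m n \<phi>" for c n m \<phi>
  proof -
    have "is_cube n c" using that(1) by (intro is_cube_of_mem) (simp add: group_nilspace_def)
    then have "is_cube m (\<lambda>v. c (\<phi> v))"
      by (rule is_cube_pullback[OF cube_morphism_coordinatewise[OF that(2)]])
    then show ?thesis unfolding compose_def mem_cubes_iff .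
  qed
  show "cubes (group_nilspace G F) 1 = cube 1 \<rightarrow>\<^sub>E points (group_nilspace G F)"
  proof (intro equalityI sub subsetI)
    fix c assume "c \<in> cube 1 \<rightarrow>\<^sub>E points (group_nilspace G F)"
    then have c: "c \<in> cube 1 \<rightarrow>\<^sub>E carrier G" by (simp add: group_nilspace_def)
    then have "is_cube 1 c" by (intro is_cube_1) auto
    then show "c \<in> cubes (group_nilspace G F) 1"
      using c by (metis PiE_restrict mem_cubes_iff)
  qed
  fix c' n
  assume c': "c' \<in> (cube (Suc n) - {cube_top (Suc n)}) \<rightarrow>\<^sub>E points (group_nilspace G F)"
    and faces: "\<And>i. i < Suc n \<Longrightarrow> (\<lambda>v\<in>cube n. c' (insert_zero n i v)) \<in> cubes (group_nilspace G F) n"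
  have "c' v \<in> carrier G" if "v \<in> cube (Suc n)" "v \<noteq> cube_top (Suc n)" for v
    using c' that by (auto simp: group_nilspace_def)
  moreover have "is_cube n (\<lambda>v. c' (insert_zero n i v))" if "i < Suc n" for i
    using faces[OF that] unfolding mem_cubes_iff .
  ultimately obtain e where e: "is_cube (Suc n) e"
      "\<And>v. v \<in> cube (Suc n) \<Longrightarrow> (\<exists>j<Suc n. v j = 0) \<Longrightarrow> e v = c' v"
    using completion_is_cube[of n c' "Suc n"] by blast
  have "\<exists>j<Suc n. v j = 0" if "v \<in> cube (Suc n)" "v \<noteq> cube_top (Suc n)" for v
    using that cube_coord cube_eq_topI by blast
  then have "\<forall>v\<in>cube (Suc n) - {cube_top (Suc n)}. restrict e (cube (Suc n)) v = c' v"
    using e(2) by auto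
  then show "\<exists>c\<in>cubes (group_nilspace G F) (Suc n). \<forall>v\<in>cube (Suc n) - {cube_top (Suc n)}. c v = c' v"
    using e(1) mem_cubes_iff by blast
qed

end

section \<open>Morphisms from a degree-one nilspace\<close>

text \<open>
  For \<open>p = 0\<close> the reduction is the identity, so that this covers the cubes of both \<open>\<D>\<^sub>1(\<int>\<^sup>n)\<close> and
  \<open>\<D>\<^sub>1(\<int>\<^sub>p\<^sup>n)\<close>.
\<close>
definition affine_cube :: "nat \<Rightarrow> nat \<Rightarrow> nat \<Rightarrow> (nat \<Rightarrow> int) \<Rightarrow> (nat \<Rightarrow> nat \<Rightarrow> int) \<Rightarrow> (nat \<Rightarrow> int) \<Rightarrow> (nat \<Rightarrow> int)" where
  "affine_cube p n m x h v = (\<lambda>k\<in>{..<n}. (x k + (\<Sum>i<m. v i * h i k)) mod int p)"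

lemma comm_group_mod_power_group: "comm_group (mod_power_group p n)"
  unfolding mod_power_group_def
  by (rule group.group_comm_groupI) (auto simp: add.commute)

lemma affine_cube_eq:
  assumes h: "h \<in> {..<m} \<rightarrow> carrier (mod_power_group p n)"
  shows "x \<otimes>\<^bsub>mod_power_group p n\<^esub> (\<Otimes>\<^bsub>mod_power_group p n\<^esub>i\<in>{..<m}. h i [^]\<^bsub>mod_power_group p n\<^esub> v i)
    = affine_cube p n m x h v"
proof -
  interpret A: comm_group "mod_power_group p n" by (rule comm_group_mod_power_group)
  have pow: "(y [^]\<^bsub>mod_power_group p n\<^esub> (z::int)) k = (z * y k) mod int p"
    if "y \<in> carrier (mod_power_group p n)" "k < n" for y z k
  proof -
    have "(\<lambda>y. y k) \<in> hom (mod_power_group p n) (integer_mod_group p)"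
      using that(2) by (auto simp: hom_def mod_power_group_def)
    then show ?thesis
      using hom_int_pow[of "\<lambda>y. y k" "mod_power_group p n" "integer_mod_group p" y z] that A.is_group
      by (simp add: int_pow_integer_mod_group)
  qed
  have closed: "i < m \<Longrightarrow> h i [^]\<^bsub>mod_power_group p n\<^esub> v i \<in> carrier (mod_power_group p n)" for i
    using h by (intro A.int_pow_closed) auto
  have "(\<Otimes>\<^bsub>mod_power_group p n\<^esub>i\<in>I. h i [^]\<^bsub>mod_power_group p n\<^esub> v i) k = (\<Sum>i\<in>I. v i * h i k) mod int p"
    if "finite I" "I \<subseteq> {..<m}" "k < n" for I k
    using that
  proof (induction I)
    case empty
    show ?case using empty unfolding A.finprod_empty by (simp add: mod_power_group_def)
  next
    case (insert i I)
    have "(\<Otimes>\<^bsub>mod_power_group p n\<^esub>i\<in>insert i I. h i [^]\<^bsub>mod_power_group p n\<^esub> v i)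
       = h i [^]\<^bsub>mod_power_group p n\<^esub> v i \<otimes>\<^bsub>mod_power_group p n\<^esub> (\<Otimes>\<^bsub>mod_power_group p n\<^esub>i\<in>I. h i [^]\<^bsub>mod_power_group p n\<^esub> v i)"
      using insert closed by (intro A.finprod_insert) auto
    moreover have "(y \<otimes>\<^bsub>mod_power_group p n\<^esub> y') k = (y k + y' k) mod int p" for y y'
      using insert.prems by (simp add: mod_power_group_def)
    moreover have "h i \<in> carrier (mod_power_group p n)" using h insert.prems by auto
    ultimately show ?case
      using insert pow[of "h i" k "v i"] by (simp add: mod_simps)
  qed
  then show ?thesis
    by (auto simp: affine_cube_def fun_eq_iff mod_power_group_def mod_simps)
qed

lemma affine_cube_closed: 
  assumes "p > 0" shows "affine_cube p n m x h v \<in> carrier (mod_power_group p n)"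
  using assms by (auto simp: affine_cube_def carrier_mod_power_group)

context filtered_group
begin

lemma nilspace_hom_iff:
  "f \<in> nilspace_hom (degree1_nilspace (mod_power_group p n)) (group_nilspace G F) \<longleftrightarrow>
     f \<in> carrier (mod_power_group p n) \<rightarrow>\<^sub>E carrier G \<and>
     (\<forall>m. \<forall>x\<in>carrier (mod_power_group p n). \<forall>h\<in>{..<m} \<rightarrow> carrier (mod_power_group p n).
        is_cube m (\<lambda>v. f (affine_cube p n m x h v)))"
proof -
  let ?A = "mod_power_group p n"
  define C where "C m x h = (\<lambda>v\<in>cube m. x \<otimes>\<^bsub>?A\<^esub> (\<Otimes>\<^bsub>?A\<^esub>i\<in>{..<m}. h i [^]\<^bsub>?A\<^esub> v i))" for m x h
  have C: "compose (cube m) f (C m x h) \<in> cubes (group_nilspace G F) m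
        \<longleftrightarrow> is_cube m (\<lambda>v. f (affine_cube p n m x h v))"
    if "h \<in> {..<m} \<rightarrow> carrier ?A" for m x h
  proof -
    have "compose (cube m) f (C m x h) = restrict (\<lambda>v. f (affine_cube p n m x h v)) (cube m)"
      using that by (auto simp: C_def compose_def affine_cube_eq fun_eq_iff)
    then show ?thesis by (simp only: mem_cubes_iff)
  qed
  have "f \<in> nilspace_hom (degree1_nilspace ?A) (group_nilspace G F) \<longleftrightarrow>
     f \<in> carrier ?A \<rightarrow>\<^sub>E carrier G \<and> (\<forall>m. \<forall>c \<in> {C m x h | x h. x \<in> carrier ?A \<and> h \<in> {..<m} \<rightarrow> carrier ?A}.
        compose (cube m) f c \<in> cubes (group_nilspace G F) m)"
    unfolding nilspace_hom_def degree1_nilspace_def C_def by (simp add: group_nilspace_def)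
  also have "\<dots> \<longleftrightarrow> f \<in> carrier ?A \<rightarrow>\<^sub>E carrier G \<and> (\<forall>m. \<forall>x\<in>carrier ?A. \<forall>h\<in>{..<m} \<rightarrow> carrier ?A.
        compose (cube m) f (C m x h) \<in> cubes (group_nilspace G F) m)"
    by blast
  finally show ?thesis by (simp only: C cong: ball_cong)
qed

text \<open>
  Used with \<open>u k\<close> the identity, a binomial coefficient, or a binomial coefficient of the residue modulo
  \<open>p\<close>: the exponents that occur in morphisms on \<open>\<int>\<^sup>n\<close> and in their reductions.
\<close>
lemma is_cube_pow_prod:
  fixes \<alpha> :: "nat \<Rightarrow> nat"
  assumes gc: "g \<in> carrier G" and g: "\<And>t. g [^] (q ^ t) \<in> F ((\<Sum>k<n. \<alpha> k) + t * r)"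
    and u: "\<And>k. k < n \<Longrightarrow> diff_order q r (int (\<alpha> k)) (u k)"
  shows "is_cube m (\<lambda>v. g [^] (\<Prod>k<n. u k (x k + (\<Sum>i<m. v i * h i k))))"
proof (rule is_cube_pow_weighted_poly[OF gc g])
  have "(\<lambda>v. \<Prod>k<n. u k (x k + (\<Sum>i<m. v i * h i k))) \<in> weighted_poly q r m (\<Sum>k<n. int (\<alpha> k))"
  proof (rule weighted_poly_prod)
    fix k assume "k \<in> {..<n}"
    then show "(\<lambda>v. u k (x k + (\<Sum>i<m. v i * h i k))) \<in> weighted_poly q r m (int (\<alpha> k))"
      using u by (intro weighted_poly_of_diff_order) auto
  qed simp
  then show "(\<lambda>v. \<Prod>k<n. u k (x k + (\<Sum>i<m. v i * h i k))) \<in> weighted_poly q r m (int (\<Sum>k<n. \<alpha> k))"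
    by simp
qed

lemma pow_zero_power_mem: "g \<in> F k \<Longrightarrow> g [^] (0 ^ t :: int) \<in> F (k + t * r)"
  using filtration_subgroup subgroup.one_closed F_subset by (cases t) fastforce+

lemma pow_prime_power_mem:
  assumes "p_homogeneous_filtration p G F" "p > 0" "g \<in> F k"
  shows "g [^] (int p ^ t) \<in> F (k + t * (p - 1))"
proof (induction t)
  case 0
  then show ?case using assms F_subset by simp
next
  case (Suc t)
  then have "(g [^] (int p ^ t)) [^] p \<in> F (k + t * (p - 1) + p - 1)"
    using assms(1) unfolding p_homogeneous_filtration_def by blast
  moreover have "(g [^] (int p ^ t)) [^] p = g [^] (int p ^ Suc t)"
    using assms F_subset by (metis int_pow_int int_pow_pow mult.commute power_Suc)
  moreover have "k + t * (p - 1) + p - 1 = k + Suc t * (p - 1)" using assms(2) by simp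
  ultimately show ?case by metis
qed

section \<open>From homogeneous nilspaces to homogeneous filtrations\<close>

text \<open>
  The case \<open>i = 0\<close> follows from \<open>i = 1\<close>, since \<open>G\<^sub>0 = G\<^sub>1\<close> and \<open>G\<^sub>p \<subseteq> G\<^bsub>p-1\<^esub>\<close>. For \<open>Suc i\<close> the
  cubes compared have dimension \<open>p + i\<close>.
\<close>
lemma p_homogeneous_filtration_of_nilspace:
  assumes p: "prime p" and hom: "p_homogeneous_nilspace p (group_nilspace G F)"
  shows "p_homogeneous_filtration p G F"
proof -
  have p2: "p \<ge> 2" using p by (rule prime_ge_2_nat)
  have pos: "g [^] p \<in> F (p + i)" if g: "g \<in> F (Suc i)" for g i
  proof -
    have gc: "g \<in> carrier G" using g F_subset by blast
    define f where "f = (\<lambda>x\<in>carrier (mod_power_group 0 (Suc i)). g [^] (\<Prod>k<Suc i. x k))"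
        \<comment> \<open>A product of \<open>Suc i\<close> affine functions has degree \<open>Suc i\<close>; \<open>q = 0\<close> selects the ordinary degree.\<close>
have f_hom: "f \<in> nilspace_hom (degree1_nilspace (int_power_group (Suc i))) (group_nilspace G F)"
      unfolding int_power_group_eq nilspace_hom_iff
    proof (intro conjI allI ballI)
      show "f \<in> carrier (mod_power_group 0 (Suc i)) \<rightarrow>\<^sub>E carrier G"
        using gc by (auto simp: f_def)
      fix m x h
      have "g [^] (0 ^ t :: int) \<in> F ((\<Sum>k<Suc i. 1) + t * 1)" for t
        using pow_zero_power_mem[OF g, of t 1] by simp
      from is_cube_pow_prod[OF gc this, of "\<lambda>_ z. z" m x h]
      have "is_cube m (\<lambda>v. g [^] (\<Prod>k<Suc i. x k + (\<Sum>j<m. v j * h j k)))"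
        by (simp add: diff_order_identity del: prod.lessThan_Suc)
      then show "is_cube m (\<lambda>v. f (affine_cube 0 (Suc i) m x h v))"
        by (rule is_cube_cong)
          (auto simp: f_def affine_cube_def carrier_int_power_group[unfolded int_power_group_eq]
            simp del: prod.lessThan_Suc intro!: arg_cong[where f = "\<lambda>z. g [^] (z::int)"] prod.cong)
    qed
    define N where "N = p + i"
    define x :: "nat \<Rightarrow> int" where "x = (\<lambda>k\<in>{..<Suc i}. 0)"
        \<comment> \<open>Coordinate \<open>0\<close> of this cube is \<open>v\<^sub>0 + \<cdots> + v\<^bsub>p-1\<^esub>\<close> and coordinate \<open>Suc k\<close> is \<open>v\<^bsub>p+k\<^esub>\<close>.\<close>
define h :: "nat \<Rightarrow> nat \<Rightarrow> int" where
      "h j = (\<lambda>k\<in>{..<Suc i}. if (if k = 0 then j < p else j = p + (k - 1)) then 1 else 0)" for j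
    have x: "x \<in> carrier (mod_power_group q (Suc i))" if "q = 0 \<or> q = p" for q
      using that p2 carrier_int_power_group[of "Suc i"]
      by (auto simp: x_def carrier_mod_power_group simp flip: int_power_group_eq)
    have h: "h \<in> {..<N} \<rightarrow> carrier (mod_power_group q (Suc i))" if "q = 0 \<or> q = p" for q
      using that p2 carrier_int_power_group[of "Suc i"]
      by (auto simp: h_def carrier_mod_power_group simp flip: int_power_group_eq)
    define s where "s v = (\<Sum>j<p. v j)" for v :: "nat \<Rightarrow> int"
    have affine_0: "affine_cube q (Suc i) N x h v 0 = s v mod int q" for q v
    proof -
      have "(\<Sum>j<N. v j * h j 0) = (\<Sum>j<N. if j \<in> {..<p} then v j else 0)"
        by (intro sum.cong) (auto simp: h_def)
      also have "\<dots> = (\<Sum>j\<in>{..<N} \<inter> {..<p}. v j)" by (simp add: sum.inter_restrict)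
      also have "{..<N} \<inter> {..<p} = {..<p}" by (auto simp: N_def)
      finally show ?thesis by (simp add: affine_cube_def x_def s_def)
    qed
    have affine_Suc: "affine_cube q (Suc i) N x h v (Suc k) = v (p + k) mod int q" if "k < i" for q v k
    proof -
      have "(\<Sum>j<N. v j * h j (Suc k)) = (\<Sum>j<N. if j = p + k then v j else 0)"
        using that by (intro sum.cong) (auto simp: h_def)
      also have "\<dots> = v (p + k)" using that by (subst sum.delta) (auto simp: N_def)
      finally show ?thesis using that by (simp add: affine_cube_def x_def)
    qed
    have f_value: "f (affine_cube q (Suc i) N x h v) = g [^] ((s v mod int q) * (\<Prod>k<i. v (p + k)))"
      if "v \<in> cube N" "q = 0 \<or> q = p" for v q
    proof -
      have "affine_cube q (Suc i) N x h v \<in> carrier (mod_power_group 0 (Suc i))"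
        by (simp add: affine_cube_def carrier_int_power_group flip: int_power_group_eq)
      moreover have "v (p + k) mod int q = v (p + k)" if "k < i" for k
        using \<open>q = 0 \<or> q = p\<close> p2 that cube_coord[OF \<open>v \<in> cube N\<close>, of "p + k"] by (auto simp: N_def)
      ultimately show ?thesis
        by (simp add: f_def affine_0 affine_Suc prod.lessThan_Suc_shift del: prod.lessThan_Suc)
    qed
    have "is_cube N (\<lambda>v. f (affine_cube 0 (Suc i) N x h v))"
      using f_hom x[of 0] h[of 0] unfolding int_power_group_eq nilspace_hom_iff by blast
    then have cube_int: "is_cube N (\<lambda>v. g [^] (s v * (\<Prod>k<i. v (p + k))))"
      by (rule is_cube_cong) (simp add: f_value)
    have "restrict f (carrier (mod_power_group p (Suc i)))
        \<in> nilspace_hom (degree1_nilspace (mod_power_group p (Suc i))) (group_nilspace G F)"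
      using hom f_hom unfolding p_homogeneous_nilspace_def by simp
    then have "is_cube N (\<lambda>v. restrict f (carrier (mod_power_group p (Suc i))) (affine_cube p (Suc i) N x h v))"
      using x[of p] h[of p] unfolding nilspace_hom_iff by blast
    then have cube_mod: "is_cube N (\<lambda>v. g [^] ((s v mod int p) * (\<Prod>k<i. v (p + k))))"
      by (rule is_cube_cong) (use p2 in \<open>simp add: f_value affine_cube_closed\<close>)
    define c where "c v = g [^] (s v * (\<Prod>k<i. v (p + k))) \<otimes> inv (g [^] ((s v mod int p) * (\<Prod>k<i. v (p + k))))" for v
    have "is_cube N c"
      unfolding c_def by (intro is_cube_mult is_cube_inv cube_int cube_mod)
    moreover have "c v = \<one>" if v: "v \<in> cube N" "v \<noteq> cube_top N" for v
    proof -
      note s_range = sum_cube_eq_card_iff[OF v(1), of "{..<p}", folded s_def]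
            \<comment> \<open>If the sum reaches \<open>p\<close> away from the top vertex, then one of the other coordinates is \<open>0\<close>.\<close>
have eq: "s v * (\<Prod>k<i. v (p + k)) = (s v mod int p) * (\<Prod>k<i. v (p + k))"
      proof (cases "s v = int p")
        case True
        then have "\<forall>j<p. v j = 1" using s_range(3) by (auto simp: N_def)
        moreover obtain j where "j < N" "v j \<noteq> 1" using v cube_eq_topI by blast
        ultimately have "j \<ge> p" "v j = 0" using cube_coord[OF v(1)] by (auto simp: not_less[symmetric])
        then have "(\<Prod>k<i. v (p + k)) = 0"
          using \<open>j < N\<close> by (intro prod_zero bexI[of _ "j - p"]) (auto simp: N_def)
        then show ?thesis by simp
      next
        case False
        then have "s v < int p" "0 \<le> s v" using s_range(1,2) by (auto simp: N_def)
        then show ?thesis by simp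
      qed
      show ?thesis unfolding c_def eq using gc by (simp add: r_inv)
    qed
    ultimately have "c (cube_top N) \<in> F N" by (rule is_cube_top_value)
    moreover have "s (cube_top N) = int p" by (simp add: s_def cube_top_def N_def)
    moreover have "(\<Prod>k<i. cube_top N (p + k)) = 1" by (simp add: cube_top_def N_def)
    ultimately show ?thesis using gc by (simp add: c_def N_def int_pow_int)
  qed
  show ?thesis
    unfolding p_homogeneous_filtration_def
  proof (intro allI ballI)
    fix i g assume g: "g \<in> F i"
    show "g [^] p \<in> F (i + p - 1)"
    proof (cases i)
      case 0
      then have "g \<in> F (Suc 0)" using g filtration_0 filtration_1 by simp
      then have "g [^] p \<in> F p" using pos[of g 0] by simp
      then show ?thesis using 0 F_antimono[of "p - 1" p] by simp
    next
      case (Suc i')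
      then show ?thesis using pos[of g i'] g by (simp add: add.commute)
    qed
  qed
qed

section \<open>From homogeneous filtrations to homogeneous nilspaces\<close>

text \<open>
  The Newton expansion of \<open>f\<close> on the box, one point at a time. The set \<open>U\<close> of points where \<open>f\<close> may
  still be nontrivial is upward closed. At a minimal point \<open>\<alpha>\<close> of \<open>U\<close> the value \<open>g\<close> of \<open>f\<close> lies in
  \<open>G\<^bsub>|\<alpha>|\<^esub>\<close>: the map \<open>v \<mapsto> f(y)\<close>, where \<open>y\<^sub>k\<close> is the sum of \<open>\<alpha>\<^sub>k\<close> of the \<open>|\<alpha>|\<close> cube coordinates, is a cube that is
  trivial below its top vertex. Dividing \<open>f\<close> by the power of \<open>g\<close> with exponent \<open>\<Prod>\<^sub>k binom(x\<^sub>k, \<alpha>\<^sub>k)\<close>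
  removes \<open>\<alpha>\<close> from \<open>U\<close>, as this exponent is \<open>1\<close> at \<open>\<alpha>\<close> and vanishes at points of the box that are not
  above \<open>\<alpha>\<close>. The factor divided out sends reduced affine cubes to cubes.
\<close>
lemma is_cube_reduction:
  assumes p: "prime p" and hom: "p_homogeneous_filtration p G F"
    and "U \<subseteq> carrier (mod_power_group p n)"
    and "\<And>x y. \<lbrakk>x \<in> U; y \<in> carrier (mod_power_group p n); \<forall>k<n. x k \<le> y k\<rbrakk> \<Longrightarrow> y \<in> U"
    and "f \<in> nilspace_hom (degree1_nilspace (mod_power_group 0 n)) (group_nilspace G F)"
    and "\<And>x. x \<in> carrier (mod_power_group p n) - U \<Longrightarrow> f x = \<one>"
  shows "is_cube m (\<lambda>v. f (affine_cube p n m x h v))"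
  using assms(3-)
proof (induction "card U" arbitrary: U f rule: less_induct)
  case less
  note upclosed = less.prems(2) and f_hom = less.prems(3)[unfolded nilspace_hom_iff]
    and f_trivial = less.prems(4)
  have p0: "p > 0" using p by (simp add: prime_gt_0_nat)
  note box = carrier_mod_power_group[OF p0, of n]
  have "finite (carrier (mod_power_group p n))" by (simp add: box finite_PiE)
  then have "finite U" using less.prems(1) finite_subset by blast
  have box_Z: "y \<in> carrier (mod_power_group 0 n)" if "y \<in> carrier (mod_power_group p n)" for y
    using that carrier_int_power_group[of n] by (auto simp: box simp flip: int_power_group_eq)
  show ?case
  proof (cases "U = {}")
    case True
    then show ?thesis
      using f_trivial affine_cube_closed[OF p0] by (intro is_cube_cong[OF is_cube_one]) auto
  next
    case False
        \<comment> \<open>Minimal coordinate sum makes \<open>\<alpha>\<close> minimal in the product order.\<close>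
define \<alpha> where "\<alpha> = arg_min_on (\<lambda>x. \<Sum>k<n. x k) U"
    have \<alpha>: "\<alpha> \<in> U" "\<And>x. x \<in> U \<Longrightarrow> (\<Sum>k<n. \<alpha> k) \<le> (\<Sum>k<n. x k)"
      using arg_min_if_finite(1)[OF \<open>finite U\<close> False] arg_min_least[OF \<open>finite U\<close> False]
      by (auto simp: \<alpha>_def)
    have \<alpha>_box: "\<alpha> \<in> {..<n} \<rightarrow>\<^sub>E {0..<int p}" using \<alpha>(1) less.prems(1) box by blast
    define a where "a k = nat (\<alpha> k)" for k
    have a: "int (a k) = \<alpha> k" "a k < p" if "k < n" for k
      using PiE_mem[OF \<alpha>_box, of k] that by (auto simp: a_def)
    define g where "g = f \<alpha>"
    have g: "g \<in> F (\<Sum>k<n. a k)"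
    proof -
      define N where "N = (\<Sum>k<n. a k)"
      have "card (SIGMA k:{..<n}. {..<a k}) = N" by (simp add: N_def)
      then obtain \<kappa> where \<kappa>: "bij_betw \<kappa> {..<N} (SIGMA k:{..<n}. {..<a k})"
        using finite_same_card_bij[of "{..<N}" "SIGMA k:{..<n}. {..<a k}"] by auto
            \<comment> \<open>The blocks \<open>B k\<close> of sizes \<open>a k\<close> partition the \<open>N\<close> cube coordinates.\<close>
define B where "B k = {j. j < N \<and> fst (\<kappa> j) = k}" for k
      have card_B: "card (B k) = a k" if "k < n" for k
      proof -
        have "bij_betw \<kappa> (B k) ({k} \<times> {..<a k})"
          using \<kappa> that by (auto simp: bij_betw_def inj_on_def B_def image_iff set_eq_iff) (metis fst_conv lessThan_iff mem_Sigma_iff)+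
        then show ?thesis using bij_betw_same_card by fastforce
      qed
      define x0 :: "nat \<Rightarrow> int" where "x0 = (\<lambda>k\<in>{..<n}. 0)"
            \<comment> \<open>Sums over the blocks map \<open>{0,1}\<^sup>N\<close> to the points below \<open>\<alpha>\<close>, and only the top vertex to \<open>\<alpha>\<close>.\<close>
define e :: "nat \<Rightarrow> nat \<Rightarrow> int" where "e j = (\<lambda>k\<in>{..<n}. if fst (\<kappa> j) = k then 1 else 0)" for j
      have affine: "affine_cube 0 n N x0 e v k = (\<Sum>j\<in>B k. v j)" if "k < n" for v k
      proof -
        have "(\<Sum>j<N. v j * e j k) = (\<Sum>j<N. if j \<in> B k then v j else 0)"
          using that by (intro sum.cong) (auto simp: e_def B_def)
        also have "\<dots> = (\<Sum>j\<in>{..<N} \<inter> B k. v j)" by (simp add: sum.inter_restrict)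
        also have "{..<N} \<inter> B k = B k" by (auto simp: B_def)
        finally show ?thesis using that by (simp add: affine_cube_def x0_def)
      qed
      have "x0 \<in> carrier (mod_power_group 0 n)" "e \<in> {..<N} \<rightarrow> carrier (mod_power_group 0 n)"
        using carrier_int_power_group[of n] by (auto simp: x0_def e_def simp flip: int_power_group_eq)
      then have "is_cube N (\<lambda>v. f (affine_cube 0 n N x0 e v))"
        using f_hom by blast
      moreover have "f (affine_cube 0 n N x0 e v) = \<one>" if v: "v \<in> cube N" "v \<noteq> cube_top N" for v
      proof -
        let ?y = "affine_cube 0 n N x0 e v"
        have y: "0 \<le> ?y k" "?y k \<le> \<alpha> k" "?y k = \<alpha> k \<longleftrightarrow> (\<forall>j\<in>B k. v j = 1)" if "k < n" for k
          using sum_cube_eq_card_iff[OF v(1), of "B k"] that a(1)[OF that] card_B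
          by (auto simp: affine B_def)
        have "?y \<in> carrier (mod_power_group p n)"
          unfolding box
        proof (rule PiE_I)
          show "?y k \<in> {0..<int p}" if "k \<in> {..<n}" for k
            using that y[of k] PiE_mem[OF \<alpha>_box, of k] by auto
        qed (simp add: affine_cube_def)
        moreover have "?y \<notin> U"
        proof
          assume "?y \<in> U"
          then have "(\<Sum>k<n. \<alpha> k) \<le> (\<Sum>k<n. ?y k)" by (rule \<alpha>(2))
          obtain j where j: "j < N" "v j \<noteq> 1" using v cube_eq_topI by blast
          then have "\<kappa> j \<in> (SIGMA k:{..<n}. {..<a k})" using bij_betwE[OF \<kappa>] by simp
          then have "fst (\<kappa> j) < n" by auto
          moreover from this have "?y (fst (\<kappa> j)) < \<alpha> (fst (\<kappa> j))"
            using y[of "fst (\<kappa> j)"] j by (fastforce simp: B_def)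
          ultimately have "(\<Sum>k<n. ?y k) < (\<Sum>k<n. \<alpha> k)"
            using y(2) by (intro sum_strict_mono_ex1) auto
          then show False using \<open>(\<Sum>k<n. \<alpha> k) \<le> (\<Sum>k<n. ?y k)\<close> by simp
        qed
        ultimately show ?thesis using f_trivial by blast
      qed
      ultimately have "f (affine_cube 0 n N x0 e (cube_top N)) \<in> F N" by (rule is_cube_top_value)
      moreover have "affine_cube 0 n N x0 e (cube_top N) = \<alpha>"
      proof (rule ext)
        fix k
        show "affine_cube 0 n N x0 e (cube_top N) k = \<alpha> k"
        proof (cases "k < n")
          case True
          have "(\<Sum>j\<in>B k. cube_top N j) = (\<Sum>j\<in>B k. 1)"
            by (intro sum.cong) (auto simp: B_def cube_top_def)
          then show ?thesis using True affine card_B a by simp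
        next
          case False
          then show ?thesis using PiE_arb[OF \<alpha>_box, of k] by (simp add: affine_cube_def)
        qed
      qed
      ultimately show ?thesis by (simp add: g_def N_def)
    qed
    then have gc: "g \<in> carrier G" by (rule F_subset)
    have pow: "g [^] (int p ^ t) \<in> F ((\<Sum>k<n. a k) + t * (p - 1))" for t
      using hom p0 g by (rule pow_prime_power_mem)
    have p1: "p - 1 > 0" using prime_gt_1_nat[OF p] by simp
    define E where "E y = (\<Prod>k<n. zbinom (y k) (a k))" for y
    define f' where "f' = (\<lambda>y\<in>carrier (mod_power_group 0 n). f y \<otimes> inv (g [^] E y))"
    have fc: "f y \<in> carrier G" if "y \<in> carrier (mod_power_group 0 n)" for y
      using f_hom that by blast
    have "is_cube m (\<lambda>v. f' (affine_cube p n m x h v))"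
    proof (rule less.hyps[of "U - {\<alpha>}"])
      show "card (U - {\<alpha>}) < card U" using \<open>finite U\<close> \<alpha>(1) by (rule card_Diff1_less)
      show "U - {\<alpha>} \<subseteq> carrier (mod_power_group p n)" using less.prems(1) by blast
      show "y \<in> U - {\<alpha>}"
        if "x \<in> U - {\<alpha>}" "y \<in> carrier (mod_power_group p n)" "\<forall>k<n. x k \<le> y k" for x y
      proof -
        have "y \<noteq> \<alpha>"
        proof
          assume "y = \<alpha>"
          then have le: "\<forall>k<n. x k \<le> \<alpha> k" using that(3) by simp
          moreover have "(\<Sum>k<n. \<alpha> k) \<le> (\<Sum>k<n. x k)" using that(1) \<alpha>(2) by blast
          ultimately have "\<not> (\<exists>k\<in>{..<n}. x k < \<alpha> k)"
            using sum_strict_mono_ex1[of "{..<n}" x \<alpha>] by force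
          then have "x k = \<alpha> k" if "k < n" for k
            using le that by (meson lessThan_iff order_le_less)
          moreover have "x \<in> {..<n} \<rightarrow>\<^sub>E {0..<int p}" using that(1) less.prems(1) box by blast
          ultimately have "x = \<alpha>" using \<alpha>_box by (intro PiE_ext) auto
          then show False using that(1) by simp
        qed
        then show ?thesis using upclosed[of x y] that by blast
      qed
      show "f' \<in> nilspace_hom (degree1_nilspace (mod_power_group 0 n)) (group_nilspace G F)"
        unfolding nilspace_hom_iff
      proof (intro conjI allI ballI)
        show "f' \<in> carrier (mod_power_group 0 n) \<rightarrow>\<^sub>E carrier G"
          using fc gc by (auto simp: f'_def)
        fix m :: nat and x h
        assume xh: "x \<in> carrier (mod_power_group 0 n)" "h \<in> {..<m} \<rightarrow> carrier (mod_power_group 0 n)"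
        have "is_cube m (\<lambda>v. g [^] (\<Prod>k<n. zbinom (x k + (\<Sum>i<m. v i * h i k)) (a k)))"
          using gc pow by (rule is_cube_pow_prod[where u = "\<lambda>k z. zbinom z (a k)"])
            (rule diff_order_zbinom[OF p1])
        then have "is_cube m (\<lambda>v. f (affine_cube 0 n m x h v) \<otimes>
            inv (g [^] (\<Prod>k<n. zbinom (x k + (\<Sum>i<m. v i * h i k)) (a k))))"
          using f_hom xh by (intro is_cube_mult is_cube_inv) blast+
        then show "is_cube m (\<lambda>v. f' (affine_cube 0 n m x h v))"
          by (rule is_cube_cong)
            (auto simp: f'_def E_def affine_cube_def carrier_int_power_group[unfolded int_power_group_eq])
      qed
      show "f' y = \<one>" if y: "y \<in> carrier (mod_power_group p n) - (U - {\<alpha>})" for y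
      proof (cases "y = \<alpha>")
        case True
        have "E \<alpha> = 1"
          unfolding E_def
        proof (rule prod.neutral, rule ballI)
          fix k assume "k \<in> {..<n}"
          then show "zbinom (\<alpha> k) (a k) = 1" using a(1)[of k] zbinom_of_nat[of "a k" "a k"] by simp
        qed
        then show ?thesis using True y box_Z gc by (simp add: f'_def g_def r_inv)
      next
        case False
        then have "y \<notin> U" using y by blast
        then obtain k where k: "k < n" "\<not> \<alpha> k \<le> y k" using upclosed \<alpha>(1) y by blast
        have "y \<in> {..<n} \<rightarrow>\<^sub>E {0..<int p}" using y box by blast
        then have "y k = int (nat (y k))" "nat (y k) < a k"
          using k PiE_mem[of y "{..<n}" "\<lambda>_. {0..<int p}" k] by (auto simp: a_def)
        then have "zbinom (y k) (a k) = 0" using zbinom_of_nat[of "nat (y k)" "a k"] by simp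
        then have "E y = 0" unfolding E_def using k by (intro prod_zero) auto
        moreover have "f y = \<one>" using f_trivial y \<open>y \<notin> U\<close> by blast
        ultimately show ?thesis using y box_Z by (simp add: f'_def)
      qed
    qed
    moreover have "is_cube m (\<lambda>v. g [^] (\<Prod>k<n. zbinom ((x k + (\<Sum>i<m. v i * h i k)) mod int p) (a k)))"
      using gc pow by (rule is_cube_pow_prod[where u = "\<lambda>k z. zbinom (z mod int p) (a k)"])
        (rule diff_order_zbinom_mod[OF p a(2)])
    ultimately have "is_cube m (\<lambda>v. f' (affine_cube p n m x h v) \<otimes>
        g [^] (\<Prod>k<n. zbinom ((x k + (\<Sum>i<m. v i * h i k)) mod int p) (a k)))"
      by (rule is_cube_mult)
    then show ?thesis
    proof (rule is_cube_cong)
      fix v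
      let ?y = "affine_cube p n m x h v"
      have "?y \<in> carrier (mod_power_group 0 n)" using affine_cube_closed[OF p0] box_Z by blast
      moreover have "(\<Prod>k<n. zbinom ((x k + (\<Sum>i<m. v i * h i k)) mod int p) (a k)) = E ?y"
        by (simp add: E_def affine_cube_def)
      ultimately show "f ?y = f' ?y \<otimes>
          g [^] (\<Prod>k<n. zbinom ((x k + (\<Sum>i<m. v i * h i k)) mod int p) (a k))"
        using fc gc by (simp add: f'_def m_assoc l_inv)
    qed
  qed
qed

lemma p_homogeneous_nilspace_of_filtration:
  assumes p: "prime p" and hom: "p_homogeneous_filtration p G F"
  shows "p_homogeneous_nilspace p (group_nilspace G F)"
  unfolding p_homogeneous_nilspace_def
proof (intro conjI allI impI ballI nilspace_group_nilspace)
  fix n f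
  assume f: "f \<in> nilspace_hom (degree1_nilspace (int_power_group n)) (group_nilspace G F)"
  have p0: "p > 0" using p by (simp add: prime_gt_0_nat)
  have f': "f \<in> nilspace_hom (degree1_nilspace (mod_power_group 0 n)) (group_nilspace G F)"
    using f by (simp add: int_power_group_eq)
  have "is_cube m (\<lambda>v. f (affine_cube p n m x h v))" for m x h
    by (rule is_cube_reduction[OF p hom _ _ f', of "carrier (mod_power_group p n)"]) auto
  then have "is_cube m (\<lambda>v. restrict f (carrier (mod_power_group p n)) (affine_cube p n m x h v))" for m x h
    by (rule is_cube_cong) (simp add: affine_cube_closed[OF p0])
  moreover have "restrict f (carrier (mod_power_group p n)) \<in> carrier (mod_power_group p n) \<rightarrow>\<^sub>E carrier G"
    using f' unfolding nilspace_hom_iff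
    by (auto simp: carrier_mod_power_group[OF p0] carrier_int_power_group[unfolded int_power_group_eq])
  ultimately show "restrict f (carrier (mod_power_group p n))
      \<in> nilspace_hom (degree1_nilspace (mod_power_group p n)) (group_nilspace G F)"
    unfolding nilspace_hom_iff by blast
qed

end

theorem theorem1p4:
  fixes G :: "('a, 'b) monoid_scheme" and F :: "nat \<Rightarrow> 'a set" and p :: nat
  assumes "prime p"
    and "filtered_group G F"
  shows "p_homogeneous_nilspace p (group_nilspace G F) \<longleftrightarrow> p_homogeneous_filtration p G F"
proof -
  interpret filtered_group G F by fact
  show ?thesis
    using assms(1) p_homogeneous_filtration_of_nilspace p_homogeneous_nilspace_of_filtration by blast
qed

end
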